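(* Suppose $R\in\mathbb{R}^{n\times r}$ with $G(R)\in\mathcal{K}$ is a regular, rank deficient (i.e. $\mathrm{rank}(R)<r$) second order stationary point of $$\text{(SDPLR1)}\quad \min\left\{\tfrac12\langle C,RR^\top\rangle:\ R\in\mathbb{R}^{n\times r},\ \mathcal{A}(RR^\top)=b,\ R^\top e=0,\ \|R\|_2\le\sqrt{\alpha}\right\}.$$ Then $RR^\top$ is a global optimal solution of $$\text{(SDP1)}\quad \min\left\{\langle C,X\rangle:\ X\in\mathbb{S}^n,\ \mathcal{A}(X)=b,\ Xe=0,\ \langle X,ee^\top\rangle=0,\ \alpha I\succeq X\succeq 0\right\},$$ and hence $R$ is a global optimal solution of (SDPLR1).
   Context: $\mathbb{S}^n$ is the space of real symmetric $n\times n$ matrices; $\langle\cdot,\cdot\rangle$ is the trace inner product. Data: $C\in\mathbb{S}^n$, linear $\mathcal{A}:\mathbb{S}^n\to\mathbb{R}^{m-1}$ with adjoint $\mathcal{A}^*$, $b\in\mathbb{R}^{m-1}$, $\alpha>0$; $e\in\mathbb{R}^n$ is the all-ones vector; $\|\cdot\|_2$ is the spectral norm. $\Omega^2_\alpha:=\{R\in\mathbb{R}^{n\times r}:\|R\|_2\le\sqrt\alpha\}$ with (convex) normal cone $\mathcal{N}_{\Omega^2_\alpha}(R)$. $G(R):=\left(\frac{\mathcal{A}(RR^\top)-b}{2},R^\top e,R\right)$ and $\mathcal{K}:=\{0\}^{m-1}\times\{0\}^r\times\Omega^2_\alpha$, so (SDPLR1) is $\min\{\frac12\langle C,RR^\top\rangle: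 G(R)\in\mathcal{K}\}$. $g_R(H):=\left(\frac12\mathcal{A}(RH^\top+HR^\top),H^\top e\right)$; $G'(R)[H]=(g_R(H),H)$ and $G''(R)[H,H]=(\mathcal{A}(HH^\top),0,0)$. Regular: let $U_1,V_1$ be the matrices of left and right singular vectors in an SVD of $R$ for the singular values equal to $\sqrt\alpha$ (possibly none), and $\Gamma_R:=\{H\in\mathbb{R}^{n\times r}: U_1^\top HV_1+V_1^\top H^\top U_1=0\}$ (all of $\mathbb{R}^{n\times r}$ if there are none). A point $R$ with $G(R)\in\mathcal{K}$ is regular if $g_R(\Gamma_R)=\mathbb{R}^{m-1}\times\mathbb{R}^r$. Second order stationary point: $R$ satisfies the first and second order necessary conditions: (1) $G(R)\in\mathcal{K}$ and there is $(y,z)\in\mathbb{R}^{m-1}\times\mathbb{R}^r$ with $(C-\mathcal{A}^*(y))R-ez^\top\in-\mathcal{N}_{\Omega^2_\alpha}(R)$; (2) for all $d,w\in\mathbb{R}^{n\times r}$ with $G'(R)d\in\mathcal{T}_{\mathcal{K}}(G(R))$ and $G'(R)w+G''(R)[d,d]\in\mathcal{T}^{i,2}_{\mathcal{K}}(G(R),G'(R)d)$: if $\langle CR,d\rangle=0$ then $\langle CR,w\rangle+\langle Cd,d\rangle\ge 0$. Here $\mathcal{T}_{\mathcal{K}}(x)$ is the tangent cone of the closed convex set $\mathcal{K}$ at $x$, and $\mathcal{T}^{i,2}_{\mathcal{K}}(x,h):=\{v:\ \mathrm{dist}(x+th+\frac12t^2v,\mathcal{K})=o(t^2),\ t\ge0\}$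 is the inner second order tangent set. *)

theory Defs
  imports "HOL-Analysis.Analysis" "HOL-Library.Landau_Symbols"
begin

text \<open>
  An \<open>n \<times> r\<close> matrix has type \<open>real^'r^'n\<close>, so that \<open>n = CARD('n)\<close> and \<open>r = CARD('r)\<close>;
  the space of multipliers \<open>\<real>\<^bsup>m-1\<^esup>\<close> is \<open>real^'k\<close> with \<open>CARD('k) = m - 1\<close>.
  On matrix types the library's \<open>\<bullet>\<close> is the trace inner product and \<open>norm\<close> the Frobenius norm;
  the spectral norm of \<open>R\<close> is \<open>onorm ((*v) R)\<close>.
\<close>

abbreviation ones :: "real^'n" where
  "ones \<equiv> vec 1"

definition outer :: "real^'n \<Rightarrow> real^'r \<Rightarrow> real^'r^'n" where
  "outer u v = (\<chi> i j. u $ i * v $ j)"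

definition sym_mats :: "(real^'n^'n) set" where
  "sym_mats = {X. transpose X = X}"

definition psd :: "real^'n^'n \<Rightarrow> bool" where
  "psd X \<longleftrightarrow> X \<in> sym_mats \<and> (\<forall>x. 0 \<le> x \<bullet> (X *v x))"

text \<open>
  A linear map on the space of symmetric matrices is a HOL function on all square matrices; only
  its values on \<open>sym_mats\<close> are constrained or used below.
\<close>

definition linear_on_sym :: "(real^'n^'n \<Rightarrow> 'b::real_vector) \<Rightarrow> bool" where
  "linear_on_sym A \<longleftrightarrow>
     (\<forall>X\<in>sym_mats. \<forall>Y\<in>sym_mats. A (X + Y) = A X + A Y) \<and>
     (\<forall>c. \<forall>X\<in>sym_mats. A (c *\<^sub>R X) = c *\<^sub>R A X)"

text \<open>
  The library's \<open>adjoint\<close> would be taken with respect to the space of all square matrices, and its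
  values need not be symmetric.
\<close>

definition sym_adjoint :: "(real^'n^'n \<Rightarrow> 'b::real_inner) \<Rightarrow> 'b \<Rightarrow> real^'n^'n" where
  "sym_adjoint A y = (THE S. S \<in> sym_mats \<and> (\<forall>X\<in>sym_mats. S \<bullet> X = y \<bullet> A X))"

lemma inner_transpose: "transpose X \<bullet> transpose Y = X \<bullet> (Y::real^'n^'m)"
  unfolding inner_vec_def transpose_def by (simp add: sum.swap[of _ "UNIV::'n set"])

lemma transpose_add: "transpose (X + Y) = transpose X + transpose (Y::real^'n^'m)"
  by (simp add: transpose_def vec_eq_iff)

lemma transpose_scaleR: "transpose (c *\<^sub>R X) = c *\<^sub>R transpose (X::real^'n^'m)"
  by (simp add: transpose_def vec_eq_iff)

lemma sym_adjoint_ex1: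
  fixes A :: "real^'n^'n \<Rightarrow> 'b::euclidean_space"
  assumes "linear_on_sym A"
  shows "\<exists>!S. S \<in> sym_mats \<and> (\<forall>X\<in>sym_mats. S \<bullet> X = y \<bullet> A X)"
proof -
  define P where "P = (\<lambda>X::real^'n^'n. (1/2) *\<^sub>R (X + transpose X))"
  have P_sym: "P X \<in> sym_mats" for X
    by (simp add: P_def sym_mats_def transpose_add transpose_scaleR add.commute)
  have P_id: "P X = X" if "X \<in> sym_mats" for X
    using that by (simp add: P_def sym_mats_def scaleR_2[symmetric])
  have P_add: "P (X + Y) = P X + P Y" for X Y
    by (simp add: P_def transpose_add algebra_simps)
  have P_scale: "P (c *\<^sub>R X) = c *\<^sub>R P X" for c X
    by (simp add: P_def transpose_scaleR algebra_simps)
  have P_inner: "P S \<bullet> X = S \<bullet> X" if "X \<in> sym_mats" for S X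
    using that inner_transpose[of S X] by (simp add: P_def sym_mats_def inner_add_left)
  have lin: "linear (\<lambda>X. A (P X))"
    by (rule linearI)
      (use assms P_sym in \<open>auto simp: linear_on_sym_def P_add P_scale\<close>)
  let ?S = "P (adjoint (\<lambda>X. A (P X)) y)"
  show ?thesis
  proof (rule ex1I[of _ ?S])
    show "?S \<in> sym_mats \<and> (\<forall>X\<in>sym_mats. ?S \<bullet> X = y \<bullet> A X)"
      using adjoint_clauses[OF lin] by (simp add: P_sym P_inner P_id)
  next
    fix S assume S: "S \<in> sym_mats \<and> (\<forall>X\<in>sym_mats. S \<bullet> X = y \<bullet> A X)"
    have eq: "S \<bullet> X = ?S \<bullet> X" if "X \<in> sym_mats" for X
      using S that adjoint_clauses[OF lin] by (simp add: P_inner P_id)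
    have "S - ?S \<in> sym_mats"
      using S P_sym[of "adjoint (\<lambda>X. A (P X)) y"]
      by (simp add: sym_mats_def transpose_def vec_eq_iff)
    from eq[OF this] have "(S - ?S) \<bullet> (S - ?S) = 0"
      by (simp add: inner_diff_left)
    then show "S = ?S" by simp
  qed
qed

lemma sym_adjoint:
  fixes A :: "real^'n^'n \<Rightarrow> 'b::euclidean_space"
  assumes "linear_on_sym A"
  shows "sym_adjoint A y \<in> sym_mats"
    and "X \<in> sym_mats \<Longrightarrow> sym_adjoint A y \<bullet> X = y \<bullet> A X"
  using theI'[OF sym_adjoint_ex1[OF assms, of y], folded sym_adjoint_def] by auto

text \<open>
  In the two tangent sets the condition is imposed for \<open>t\<close> tending to \<open>0\<close> from the right. They are
  meant for a nonempty closed \<open>K\<close> (for empty \<open>K\<close> the function \<open>infdist\<close> is \<open>0\<close> by convention),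
  and are then empty at points outside \<open>K\<close>.
\<close>

definition normal_cone :: "'a::real_inner set \<Rightarrow> 'a \<Rightarrow> 'a set" where
  "normal_cone S x = {v. x \<in> S \<and> (\<forall>y\<in>S. v \<bullet> (y - x) \<le> 0)}"

definition tangent_cone :: "'a::real_normed_vector set \<Rightarrow> 'a \<Rightarrow> 'a set" where
  "tangent_cone K x = {h. (\<lambda>t. infdist (x + t *\<^sub>R h) K) \<in> o[at_right 0](\<lambda>t. t)}"

definition inner_tangent2 :: "'a::real_normed_vector set \<Rightarrow> 'a \<Rightarrow> 'a \<Rightarrow> 'a set" where
  "inner_tangent2 K x h =
     {v. (\<lambda>t. infdist (x + t *\<^sub>R h + (t\<^sup>2 / 2) *\<^sub>R v) K) \<in> o[at_right 0](\<lambda>t. t\<^sup>2)}"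

definition Omega2 :: "real \<Rightarrow> (real^'r^'n) set" where
  "Omega2 \<alpha> = {R. onorm ((*v) R) \<le> sqrt \<alpha>}"

definition sdplr1_feasible ::
    "(real^'n^'n \<Rightarrow> real^'k) \<Rightarrow> real^'k \<Rightarrow> real \<Rightarrow> real^'r^'n \<Rightarrow> bool" where
  "sdplr1_feasible A b \<alpha> R \<longleftrightarrow>
     A (R ** transpose R) = b \<and> transpose R *v ones = 0 \<and> onorm ((*v) R) \<le> sqrt \<alpha>"

definition sdplr1_objective :: "real^'n^'n \<Rightarrow> real^'r^'n \<Rightarrow> real" where
  "sdplr1_objective C R = (1/2) * (C \<bullet> (R ** transpose R))"

definition sdp1_feasible ::
    "(real^'n^'n \<Rightarrow> real^'k) \<Rightarrow> real^'k \<Rightarrow> real \<Rightarrow> real^'n^'n \<Rightarrow> bool" where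
  "sdp1_feasible A b \<alpha> X \<longleftrightarrow>
     X \<in> sym_mats \<and> A X = b \<and> X *v ones = 0 \<and> X \<bullet> outer ones ones = 0 \<and>
     psd (\<alpha> *\<^sub>R mat 1 - X) \<and> psd X"

definition G_map :: "(real^'n^'n \<Rightarrow> real^'k) \<Rightarrow> real^'k \<Rightarrow> real^'r^'n \<Rightarrow>
    (real^'k) \<times> (real^'r) \<times> (real^'r^'n)" where
  "G_map A b R = ((1/2) *\<^sub>R (A (R ** transpose R) - b), transpose R *v ones, R)"

definition K_set :: "real \<Rightarrow> ((real^'k) \<times> (real^'r) \<times> (real^'r^'n)) set" where
  "K_set \<alpha> = {0} \<times> {0} \<times> Omega2 \<alpha>"

definition g_map :: "(real^'n^'n \<Rightarrow> real^'k) \<Rightarrow> real^'r^'n \<Rightarrow> real^'r^'n \<Rightarrow>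
    (real^'k) \<times> (real^'r)" where
  "g_map A R H = ((1/2) *\<^sub>R A (R ** transpose H + H ** transpose R), transpose H *v ones)"

definition G_deriv :: "(real^'n^'n \<Rightarrow> real^'k) \<Rightarrow> real^'r^'n \<Rightarrow> real^'r^'n \<Rightarrow>
    (real^'k) \<times> (real^'r) \<times> (real^'r^'n)" where
  "G_deriv A R H = (fst (g_map A R H), snd (g_map A R H), H)"

text \<open>The diagonal \<open>G''(R)[H,H]\<close> of the second derivative; it does not depend on \<open>R\<close>.\<close>

definition G_deriv2 :: "(real^'n^'n \<Rightarrow> real^'k) \<Rightarrow> real^'r^'n \<Rightarrow>
    (real^'k) \<times> (real^'r) \<times> (real^'r^'n)" where
  "G_deriv2 A H = (A (H ** transpose H), 0, 0)"

text \<open>The exact second order expansion, confirming that \<open>G_deriv\<close> and \<open>G_deriv2\<close> are the derivatives.\<close>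

lemma G_expansion:
  fixes A :: "real^'n^'n \<Rightarrow> real^'k" and R H :: "real^'r^'n"
  assumes "linear_on_sym A"
  shows "G_map A b (R + H) = G_map A b R + G_deriv A R H + (1/2) *\<^sub>R G_deriv2 A H"
proof -
  have sym: "R ** transpose R \<in> sym_mats" "H ** transpose H \<in> sym_mats"
    "R ** transpose H + H ** transpose R \<in> sym_mats"
    by (simp_all add: sym_mats_def matrix_transpose_mul transpose_add add.commute)
  then have sym': "R ** transpose R + (R ** transpose H + H ** transpose R) \<in> sym_mats"
    by (simp add: sym_mats_def transpose_add)
  have "(R + H) ** transpose (R + H) =
      R ** transpose R + (R ** transpose H + H ** transpose R) + H ** transpose H"
    by (simp add: vec_eq_iff matrix_matrix_mult_def transpose_def algebra_simps sum.distrib)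
  then have "A ((R + H) ** transpose (R + H)) =
      A (R ** transpose R) + A (R ** transpose H + H ** transpose R) + A (H ** transpose H)"
    using assms sym sym' by (simp add: linear_on_sym_def)
  then show ?thesis
    by (simp add: G_map_def G_deriv_def G_deriv2_def g_map_def transpose_add
        matrix_vector_mult_add_rdistrib
        algebra_simps)
qed

lemma G_in_K_set_iff: "G_map A b R \<in> K_set \<alpha> \<longleftrightarrow> sdplr1_feasible A b \<alpha> R"
  by (auto simp: G_map_def K_set_def Omega2_def sdplr1_feasible_def)

text \<open>
  \<open>is_svd R u \<sigma> v\<close>: thin singular value decomposition \<open>R = \<Sum>i<p. \<sigma>\<^sub>i u\<^sub>i v\<^sub>i\<^sup>T\<close> with
  \<open>p = min n r\<close>. Values of \<open>u\<close>, \<open>\<sigma>\<close>, \<open>v\<close> at indices \<open>i \<ge> p\<close> are irrelevant.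
\<close>

definition is_svd :: "real^'r^'n \<Rightarrow> (nat \<Rightarrow> real^'n) \<Rightarrow> (nat \<Rightarrow> real) \<Rightarrow> (nat \<Rightarrow> real^'r) \<Rightarrow> bool"
  where
  "is_svd R u \<sigma> v \<longleftrightarrow>
     (let p = min CARD('n) CARD('r) in
       (\<forall>i<p. \<forall>j<p. u i \<bullet> u j = (if i = j then 1 else 0)) \<and>
       (\<forall>i<p. \<forall>j<p. v i \<bullet> v j = (if i = j then 1 else 0)) \<and>
       (\<forall>i<p. 0 \<le> \<sigma> i) \<and> (\<forall>i<p. \<forall>j<p. i \<le> j \<longrightarrow> \<sigma> j \<le> \<sigma> i) \<and>
       R = (\<Sum>i<p. \<sigma> i *\<^sub>R outer (u i) (v i)))"

text \<open>
  The columns of \<open>U\<^sub>1\<close> and \<open>V\<^sub>1\<close> are the \<open>u i\<close> and \<open>v i\<close> with \<open>\<sigma> i = sqrt \<alpha>\<close>. Their number is not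
  a type, so \<open>U\<^sub>1\<^sup>T H V\<^sub>1 + V\<^sub>1\<^sup>T H\<^sup>T U\<^sub>1 = 0\<close> is written entrywise.
\<close>

definition Gamma_set :: "real \<Rightarrow> (nat \<Rightarrow> real^'n) \<Rightarrow> (nat \<Rightarrow> real) \<Rightarrow> (nat \<Rightarrow> real^'r) \<Rightarrow> (real^'r^'n) set"
  where
  "Gamma_set \<alpha> u \<sigma> v =
     {H. \<forall>i<min CARD('n) CARD('r). \<forall>j<min CARD('n) CARD('r).
           \<sigma> i = sqrt \<alpha> \<and> \<sigma> j = sqrt \<alpha> \<longrightarrow>
           u i \<bullet> (H *v v j) + v i \<bullet> (transpose H *v u j) = 0}"

text \<open>
  For \<open>\<alpha> > 0\<close> the set \<open>Gamma_set \<alpha> u \<sigma> v\<close> is the same for every singular value decomposition of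
  \<open>R\<close> (two choices of \<open>U\<^sub>1\<close>, \<open>V\<^sub>1\<close> differ by a common orthogonal factor on the right), and a
  decomposition always exists, so the quantifier over decompositions is immaterial.
\<close>

definition regular_point :: "(real^'n^'n \<Rightarrow> real^'k) \<Rightarrow> real^'k \<Rightarrow> real \<Rightarrow> real^'r^'n \<Rightarrow> bool" where
  "regular_point A b \<alpha> R \<longleftrightarrow>
     G_map A b R \<in> K_set \<alpha> \<and>
     (\<exists>u \<sigma> v. is_svd R u \<sigma> v \<and> g_map A R ` Gamma_set \<alpha> u \<sigma> v = UNIV)"

definition first_order_cond ::
    "real^'n^'n \<Rightarrow> (real^'n^'n \<Rightarrow> real^'k) \<Rightarrow> real^'k \<Rightarrow> real \<Rightarrow> real^'r^'n \<Rightarrow> bool" where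
  "first_order_cond C A b \<alpha> R \<longleftrightarrow>
     G_map A b R \<in> K_set \<alpha> \<and>
     (\<exists>(y::real^'k) (z::real^'r).
        (C - sym_adjoint A y) ** R - outer ones z \<in> uminus ` normal_cone (Omega2 \<alpha>) R)"

definition second_order_cond ::
    "real^'n^'n \<Rightarrow> (real^'n^'n \<Rightarrow> real^'k) \<Rightarrow> real^'k \<Rightarrow> real \<Rightarrow> real^'r^'n \<Rightarrow> bool" where
  "second_order_cond C A b \<alpha> R \<longleftrightarrow>
     (\<forall>(d::real^'r^'n) (w::real^'r^'n).
        G_deriv A R d \<in> tangent_cone (K_set \<alpha>) (G_map A b R) \<and>
        G_deriv A R w + G_deriv2 A d \<in> inner_tangent2 (K_set \<alpha>) (G_map A b R) (G_deriv A R d) \<longrightarrow>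
        (C ** R) \<bullet> d = 0 \<longrightarrow> 0 \<le> (C ** R) \<bullet> w + (C ** d) \<bullet> d)"

definition second_order_stationary ::
    "real^'n^'n \<Rightarrow> (real^'n^'n \<Rightarrow> real^'k) \<Rightarrow> real^'k \<Rightarrow> real \<Rightarrow> real^'r^'n \<Rightarrow> bool" where
  "second_order_stationary C A b \<alpha> R \<longleftrightarrow>
     first_order_cond C A b \<alpha> R \<and> second_order_cond C A b \<alpha> R"

end

theory Submission
  imports Defs
begin

text \<open>
  The optimality of \<open>R R\<^sup>T\<close> is shown by a dual certificate. Let \<open>N\<close> be the normal vector and \<open>y\<close>,
  \<open>z\<close> the multipliers of the first order condition, so that \<open>S R = e z\<^sup>T - N\<close> with
  \<open>S = C - A\<^sup>* y\<close>, and put \<open>W = N R\<^sup>T / \<alpha>\<close>, the multiplier of the constraint \<open>X \<preceq> \<alpha> I\<close>. Three facts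
  suffice. The quadratic form of \<open>W\<close> is nonnegative (\<open>normal_cone_mult_transpose_psd\<close>), whence
  \<open>\<langle>W, X\<rangle> \<le> \<alpha> tr W = \<langle>N, R\<rangle>\<close> for feasible \<open>X\<close>. The form of \<open>S + W\<close> is nonnegative on the
  orthogonal complement of \<open>e\<close> (\<open>dual_slack_nonneg\<close>), which contains the range of every feasible
  \<open>X\<close>, whence \<open>\<langle>S, X\<rangle> \<ge> - \<langle>W, X\<rangle> \<ge> - \<langle>N, R\<rangle>\<close>. Finally \<open>R\<^sup>T e = 0\<close> gives
  \<open>\<langle>S, R R\<^sup>T\<rangle> = - \<langle>N, R\<rangle>\<close>. Since \<open>\<langle>C, X\<rangle>\<close> and \<open>\<langle>S, X\<rangle>\<close> differ by the constant \<open>\<langle>y, b\<rangle>\<close> on the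
  feasible set, \<open>R R\<^sup>T\<close> is optimal. Both sign conditions are turned into trace inequalities by
  writing a positive semidefinite matrix as a sum of matrices \<open>z z\<^sup>T\<close> (\<open>inner_psd_nonneg\<close>).

  The heart is the sign of \<open>S + W\<close>. Rank deficiency yields a unit vector \<open>q\<close> with \<open>R q = 0\<close>. For
  \<open>x \<bottom> e\<close> the direction \<open>d = x q\<^sup>T\<close> has \<open>R d\<^sup>T = 0\<close>: along it the constraints are undisturbed to
  first order, the objective is stationary, and \<open>\<langle>C d, d\<rangle> = x\<^sup>T C x\<close>, so it exposes the full
  quadratic form of \<open>C\<close>. The second order effect \<open>x x\<^sup>T\<close> on \<open>R R\<^sup>T\<close> has to be compensated by some \<open>w\<close>,
  and \<open>w = h - x x\<^sup>T R / \<alpha>\<close> works: the second summand cancels \<open>x x\<^sup>T\<close> on the eigenspace of \<open>R R\<^sup>T\<close>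
  for \<open>\<alpha>\<close>, which keeps the spectral norm in bounds to second order, and regularity supplies an
  \<open>h \<in> \<Gamma>\<^sub>R\<close> that restores the linear constraints. The second order condition then reads
  \<open>0 \<le> x\<^sup>T (S + W) x\<close>, because normal vectors are orthogonal to \<open>\<Gamma>\<^sub>R\<close>.

  Spectral norms enter through one estimate, \<open>quadratic_perturbation\<close>: if a quadratic form is
  nonpositive on the eigenspace of \<open>R R\<^sup>T\<close> for \<open>\<alpha>\<close>, then adding \<open>t\<close> times it pushes the form of
  \<open>R R\<^sup>T\<close> above \<open>\<alpha>\<close> only by \<open>O(t\<^sup>2)\<close>. It determines the normal cone as far as needed and also
  yields the second order tangent vectors.
\<close>

(* Transposed products and the all-ones vector stay in the form that the definitions use. *)
declare transpose_matrix_vector [simp del] vec_1 [simp del]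

section \<open>Trace inner products\<close>

lemma inner_matrix_mult:
  fixes M :: "real^'r^'n"
  shows "x \<bullet> (M *v y) = (transpose M *v x) \<bullet> y"
  by (simp add: dot_lmul_matrix transpose_matrix_vector)

lemma outer_mult: "outer u v *v x = (v \<bullet> x) *\<^sub>R u"
  by (simp add: outer_def vec_eq_iff matrix_vector_mult_def inner_vec_def sum_distrib_right
      sum_distrib_left mult_ac)

lemma transpose_outer: "transpose (outer u v) = outer v u"
  by (simp add: outer_def vec_eq_iff transpose_def mult.commute)

lemma inner_outer: "M \<bullet> outer u v = u \<bullet> (M *v v)"
  by (simp add: outer_def inner_vec_def matrix_vector_mult_def sum_distrib_left mult_ac)

lemma outer_matrix_mult: "outer u v ** M = outer u (transpose M *v v)"
  by (simp add: outer_def vec_eq_iff matrix_matrix_mult_def matrix_vector_mult_def transpose_def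
      sum_distrib_left mult_ac)

lemma inner_mult_right_transpose:
  fixes M :: "real^'m^'n" and R :: "real^'r^'m"
  shows "(M ** R) \<bullet> D = M \<bullet> (D ** transpose R)"
proof -
  have "(M ** R) \<bullet> D = (\<Sum>i\<in>UNIV. \<Sum>j\<in>UNIV. \<Sum>k\<in>UNIV. M$i$k * R$k$j * D$i$j)"
    by (simp add: inner_vec_def matrix_matrix_mult_def sum_distrib_right)
  also have "\<dots> = (\<Sum>i\<in>UNIV. \<Sum>k\<in>UNIV. \<Sum>j\<in>UNIV. M$i$k * R$k$j * D$i$j)"
    by (intro sum.cong refl sum.swap)
  also have "\<dots> = M \<bullet> (D ** transpose R)"
    by (simp add: inner_vec_def matrix_matrix_mult_def transpose_def sum_distrib_left mult_ac)
  finally show ?thesis .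
qed

lemma transpose_diff: "transpose (X - Y) = transpose X - transpose (Y::real^'n^'m)"
  by (simp add: transpose_def vec_eq_iff)

lemma transpose_sum: "transpose (\<Sum>i\<in>I. f i) = (\<Sum>i\<in>I. transpose (f i :: real^'n^'m))"
  by (simp add: transpose_def vec_eq_iff)

lemma sum_matrix_mult: "(\<Sum>i\<in>I. f i :: real^'n^'m) *v x = (\<Sum>i\<in>I. f i *v x)"
  by (induction I rule: infinite_finite_induct) (simp_all add: matrix_vector_mult_add_rdistrib)

section \<open>Positive semidefinite matrices\<close>

text \<open>
  With zero diagonal, the form at \<open>e\<^sub>i + s e\<^sub>j\<close> is \<open>2 s Z\<^sub>i\<^sub>j\<close>, which takes both signs unless
  \<open>Z\<^sub>i\<^sub>j = 0\<close>.
\<close>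

lemma psd_eq_0_if_diagonal_0:
  assumes "psd Z" and "\<And>i. Z $ i $ i = 0"
  shows "Z = 0"
proof -
  have sym: "Z $ i $ j = Z $ j $ i" for i j
  proof -
    have "transpose Z $ i $ j = Z $ i $ j" using assms(1) by (simp add: psd_def sym_mats_def)
    then show ?thesis by (simp add: transpose_def)
  qed
  have "Z $ i $ j = 0" for i j
  proof -
    let ?x = "\<lambda>s. axis i 1 + s *\<^sub>R axis j 1"
    have "?x s \<bullet> (Z *v ?x s) = 2 * s * Z $ i $ j" for s
      using assms(2) sym[of i j]
      by (simp add: matrix_vector_right_distrib matrix_vector_mult_scaleR matrix_vector_mult_basis
          inner_add_left inner_add_right inner_axis' column_def)
    then have "?x (- sgn (Z $ i $ j)) \<bullet> (Z *v ?x (- sgn (Z $ i $ j)))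
        = 2 * - sgn (Z $ i $ j) * Z $ i $ j" .
    also have "\<dots> = - 2 * \<bar>Z $ i $ j\<bar>" by (simp add: abs_sgn)
    finally show ?thesis using assms(1) unfolding psd_def by (smt (verit) abs_ge_zero)
  qed
  then show ?thesis by (simp add: vec_eq_iff)
qed

text \<open>
  Subtracting the rank-one matrix amounts to minimising the form of \<open>Z\<close> over the \<open>k\<close>-th
  coordinate of its argument, so nonnegativity survives.
\<close>

lemma psd_schur_complement:
  assumes "psd Z" and pos: "0 < Z $ k $ k"
  shows "psd (Z - (1 / (Z $ k $ k)) *\<^sub>R outer (column k Z) (column k Z))"
proof -
  let ?z = "column k Z" and ?a = "Z $ k $ k"
  have Zt: "transpose Z = Z" and nn: "0 \<le> x \<bullet> (Z *v x)" for x
    using assms(1) by (simp_all add: psd_def sym_mats_def)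
  have "0 \<le> x \<bullet> (Z *v x) - (?z \<bullet> x)\<^sup>2 / ?a" for x
  proof -
    (* The point at which the form is minimal on the line through x in direction k. *)
    let ?y = "x - ((?z \<bullet> x) / ?a) *\<^sub>R axis k 1"
    have e: "axis k 1 \<bullet> (Z *v x) = ?z \<bullet> x"
      by (metis Zt inner_matrix_mult matrix_vector_mult_basis)
    have "?y \<bullet> (Z *v ?y) = x \<bullet> (Z *v x) - (?z \<bullet> x)\<^sup>2 / ?a"
      using pos e
      by (simp add: matrix_vector_mult_diff_distrib matrix_vector_mult_scaleR matrix_vector_mult_basis
          inner_diff_left inner_diff_right inner_axis' column_def[of k Z] inner_commute[of x] power2_eq_square
          field_simps)
    then show ?thesis using nn[of ?y] by simp
  qed
  then show ?thesis
    by (simp add: psd_def sym_mats_def Zt transpose_diff transpose_scaleR transpose_outer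
        matrix_vector_mult_diff_rdistrib scaleR_matrix_vector_assoc[symmetric] outer_mult inner_diff_right power2_eq_square
        inner_commute)
qed

text \<open>
  Cholesky elimination: each step clears a nonzero diagonal entry and creates no new one, because
  the diagonal of a positive semidefinite matrix is nonnegative and only decreases. Recording that
  the vectors lie in the range of \<open>Z\<close> is what lets a sign condition on a subspace be used later.
\<close>

lemma psd_sum_outer:
  assumes "psd Z"
  shows "\<exists>zs. Z = (\<Sum>z\<leftarrow>zs. outer z z) \<and> set zs \<subseteq> range ((*v) Z)"
  using assms
proof (induction "card {i. Z $ i $ i \<noteq> 0}" arbitrary: Z rule: less_induct)
  case less
  show ?case
  proof (cases "\<forall>i. Z $ i $ i = 0")
    case True
    then have "Z = 0" using psd_eq_0_if_diagonal_0 less.prems by blast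
    then show ?thesis by (intro exI[of _ "[]"]) simp
  next
    case False
    then obtain k where k: "Z $ k $ k \<noteq> 0" by blast
    have Zt: "transpose Z = Z" using less.prems by (simp add: psd_def sym_mats_def)
    have diag: "0 \<le> X $ i $ i" if "psd X" for X :: "real^'a^'a" and i
    proof -
      have "axis i 1 \<bullet> (X *v axis i 1) = X $ i $ i"
        by (simp add: matrix_vector_mult_basis inner_axis' column_def)
      then show ?thesis using that unfolding psd_def by metis
    qed
    have pos: "0 < Z $ k $ k" using diag[OF less.prems, of k] k by simp
    define z where "z = (1 / sqrt (Z $ k $ k)) *\<^sub>R column k Z"
    define Y where "Y = Z - outer z z"
    have zz: "outer z z = (1 / (Z $ k $ k)) *\<^sub>R outer (column k Z) (column k Z)"
      using pos by (simp add: z_def outer_def vec_eq_iff)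
    have Y: "psd Y"
      unfolding Y_def zz by (rule psd_schur_complement[OF less.prems pos])
    have Yii: "Y $ i $ i = Z $ i $ i - (z $ i)\<^sup>2" for i
      by (simp add: Y_def outer_def power2_eq_square)
    have "Y $ k $ k = 0"
      using pos by (simp add: Yii z_def column_def power2_eq_square)
    moreover have "Y $ i $ i = 0" if "Z $ i $ i = 0" for i
      using diag[OF Y, of i] that by (simp add: Yii)
    ultimately have "{i. Y $ i $ i \<noteq> 0} \<subset> {i. Z $ i $ i \<noteq> 0}" using k by blast
    then have "card {i. Y $ i $ i \<noteq> 0} < card {i. Z $ i $ i \<noteq> 0}"
      by (intro psubset_card_mono) auto
    from less.hyps[OF this Y] obtain zs
      where zs: "Y = (\<Sum>z\<leftarrow>zs. outer z z)" "set zs \<subseteq> range ((*v) Y)" by blast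
    have z: "z = Z *v ((1 / sqrt (Z $ k $ k)) *\<^sub>R axis k 1)"
      by (simp add: z_def matrix_vector_mult_scaleR matrix_vector_mult_basis)
    then have zr: "z \<in> range ((*v) Z)" by blast
    have "Y *v v = Z *v (v - (z \<bullet> v) *\<^sub>R ((1 / sqrt (Z $ k $ k)) *\<^sub>R axis k 1))" for v
      by (subst matrix_vector_mult_diff_distrib, subst matrix_vector_mult_scaleR, subst z[symmetric])
        (simp add: Y_def matrix_vector_mult_diff_rdistrib outer_mult)
    then have "range ((*v) Y) \<subseteq> range ((*v) Z)" by auto
    then have "set (z # zs) \<subseteq> range ((*v) Z)" using zs(2) zr by auto
    moreover have "Z = (\<Sum>z\<leftarrow>z # zs. outer z z)"
      by (simp add: zs(1)[symmetric], simp add: Y_def)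
    ultimately show ?thesis by blast
  qed
qed

lemma inner_psd_nonneg:
  assumes "psd Z" and "\<And>x. x \<in> range ((*v) Z) \<Longrightarrow> 0 \<le> x \<bullet> (M *v x)"
  shows "0 \<le> M \<bullet> Z"
proof -
  obtain zs where zs: "Z = (\<Sum>z\<leftarrow>zs. outer z z)" "set zs \<subseteq> range ((*v) Z)"
    using psd_sum_outer[OF assms(1)] by blast
  have "M \<bullet> (\<Sum>z\<leftarrow>xs. outer z z) = (\<Sum>z\<leftarrow>xs. z \<bullet> (M *v z))" for xs
    by (induction xs) (simp_all add: inner_add_right inner_outer)
  moreover have "0 \<le> (\<Sum>z\<leftarrow>zs. z \<bullet> (M *v z))"
    using zs(2) assms(2) by (intro sum_list_nonneg) auto
  ultimately show ?thesis using zs(1) by simp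
qed

section \<open>Perturbing a matrix on the boundary of the spectral norm ball\<close>

text \<open>
  A matrix and its transpose have the same spectral norm. The bound on \<open>R\<^sup>T\<close> is the convenient one
  here: perturbations in null directions of \<open>R\<close> affect \<open>R R\<^sup>T\<close> only to second order.
\<close>

lemma Omega2_iff:
  fixes R :: "real^'r^'n"
  assumes "0 < \<alpha>"
  shows "R \<in> Omega2 \<alpha> \<longleftrightarrow> (\<forall>u. (norm (transpose R *v u))\<^sup>2 \<le> \<alpha> * (norm u)\<^sup>2)"
    and "R \<in> Omega2 \<alpha> \<longleftrightarrow> (\<forall>v. (norm (R *v v))\<^sup>2 \<le> \<alpha> * (norm v)\<^sup>2)"
proof -
  have sq: "a\<^sup>2 \<le> \<alpha> * b\<^sup>2 \<longleftrightarrow> a \<le> sqrt \<alpha> * b" if "0 \<le> a" "0 \<le> b" for a b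
  proof -
    have "\<alpha> * b\<^sup>2 = (sqrt \<alpha> * b)\<^sup>2" using assms by (simp add: power_mult_distrib)
    moreover have "0 \<le> sqrt \<alpha> * b" using that assms by simp
    ultimately show ?thesis using that by (simp add: power2_le_iff_abs_le)
  qed
  show *: "R \<in> Omega2 \<alpha> \<longleftrightarrow> (\<forall>v. (norm (R *v v))\<^sup>2 \<le> \<alpha> * (norm v)\<^sup>2)" for R :: "real^'r^'n"
  proof -
    have "onorm ((*v) R) \<le> sqrt \<alpha> \<longleftrightarrow> (\<forall>v. norm (R *v v) \<le> sqrt \<alpha> * norm v)"
    proof
      assume le: "onorm ((*v) R) \<le> sqrt \<alpha>"
      show "\<forall>v. norm (R *v v) \<le> sqrt \<alpha> * norm v"
      proof
        fix v
        have "norm (R *v v) \<le> onorm ((*v) R) * norm v"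
          by (rule onorm[OF matrix_vector_mul_bounded_linear])
        also have "\<dots> \<le> sqrt \<alpha> * norm v" by (rule mult_right_mono[OF le]) simp
        finally show "norm (R *v v) \<le> sqrt \<alpha> * norm v" .
      qed
    next
      assume "\<forall>v. norm (R *v v) \<le> sqrt \<alpha> * norm v"
      then show "onorm ((*v) R) \<le> sqrt \<alpha>" by (intro onorm_le) blast
    qed
    moreover have "(norm (R *v v))\<^sup>2 \<le> \<alpha> * (norm v)\<^sup>2 \<longleftrightarrow> norm (R *v v) \<le> sqrt \<alpha> * norm v" for v
      by (rule sq) auto
    ultimately show ?thesis unfolding Omega2_def mem_Collect_eq by presburger
  qed
  have dual: "\<forall>u. (norm (transpose M *v u))\<^sup>2 \<le> \<alpha> * (norm u)\<^sup>2"
    if M: "\<forall>v. (norm (M *v v))\<^sup>2 \<le> \<alpha> * (norm v)\<^sup>2" for M :: "real^'b^'a"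
  proof
    fix u
    let ?v = "transpose M *v u"
    have "(norm ?v)\<^sup>2 = u \<bullet> (M *v ?v)" by (simp add: inner_matrix_mult power2_norm_eq_inner)
    also have "\<dots> \<le> norm u * norm (M *v ?v)" by (rule norm_cauchy_schwarz)
    also have "\<dots> \<le> norm u * (sqrt \<alpha> * norm ?v)" using M sq by (simp add: mult_left_mono)
    finally have "norm ?v * norm ?v \<le> (sqrt \<alpha> * norm u) * norm ?v"
      by (simp add: power2_eq_square mult_ac)
    then have "norm ?v \<le> sqrt \<alpha> * norm u"
      using assms by (cases "norm ?v = 0") (auto dest: mult_right_le_imp_le)
    then show "(norm ?v)\<^sup>2 \<le> \<alpha> * (norm u)\<^sup>2" by (simp add: sq)
  qed
  show "R \<in> Omega2 \<alpha> \<longleftrightarrow> (\<forall>u. (norm (transpose R *v u))\<^sup>2 \<le> \<alpha> * (norm u)\<^sup>2)"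
    unfolding * using dual[of R] dual[of "transpose R"] by auto
qed

text \<open>
  The form of \<open>F = \<alpha> I - R R\<^sup>T\<close> dominates \<open>\<delta> \<parallel>s\<parallel>\<^sup>2\<close> on the orthogonal complement of its kernel \<open>L\<close>.
  Splitting \<open>u = p + s\<close> accordingly, \<open>B\<close> is nonpositive at \<open>p\<close>, so its contribution is at most a
  multiple of \<open>t \<parallel>u\<parallel> \<parallel>s\<parallel>\<close>, and completing the square against \<open>\<delta> \<parallel>s\<parallel>\<^sup>2\<close> leaves an error of order
  \<open>t\<^sup>2 \<parallel>u\<parallel>\<^sup>2\<close>.
\<close>

lemma quadratic_perturbation:
  fixes R :: "real^'r^'n" and B :: "real^'n^'n"
  assumes \<alpha>: "0 < \<alpha>" and R: "R \<in> Omega2 \<alpha>"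
    and B: "\<And>u. R *v (transpose R *v u) = \<alpha> *\<^sub>R u \<Longrightarrow> u \<bullet> (B *v u) \<le> 0"
  obtains c where "0 \<le> c"
    and "\<And>t u. 0 \<le> t \<Longrightarrow>
      (norm (transpose R *v u))\<^sup>2 + t * (u \<bullet> (B *v u)) \<le> (\<alpha> + c * t\<^sup>2) * (norm u)\<^sup>2"
proof -
  define F where "F = (\<lambda>u. \<alpha> *\<^sub>R u - R *v (transpose R *v u))"
  have linF: "linear F"
    unfolding F_def
    by (rule linearI) (simp_all add: matrix_vector_right_distrib matrix_vector_mult_scaleR
        scaleR_right_distrib scaleR_right_diff_distrib)
  have innerF: "x \<bullet> F y = \<alpha> * (x \<bullet> y) - (transpose R *v x) \<bullet> (transpose R *v y)" for x y
    by (simp add: F_def inner_diff_right inner_matrix_mult)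
  have Fself: "x \<bullet> F y = F x \<bullet> y" for x y
    using innerF[of x y] innerF[of y x] by (simp add: inner_commute)
  have normF: "(norm (transpose R *v u))\<^sup>2 = \<alpha> * (norm u)\<^sup>2 - u \<bullet> F u" for u
    by (simp add: F_def inner_diff_right inner_matrix_mult power2_norm_eq_inner)
  (* This is the positivity of R (\<alpha> I - R^T R) R^T; it makes the form of F large
     wherever F itself is. *)
  have F2: "(norm (F s))\<^sup>2 \<le> \<alpha> * (s \<bullet> F s)" for s
  proof -
    let ?v = "transpose R *v s"
    have sw: "s \<bullet> (R *v ?v) = (norm ?v)\<^sup>2"
      by (simp add: inner_matrix_mult power2_norm_eq_inner)
    have "(norm (F s))\<^sup>2 = \<alpha> * (s \<bullet> F s) - (\<alpha> * (norm ?v)\<^sup>2 - (norm (R *v ?v))\<^sup>2)"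
      using sw by (simp add: F_def inner_diff_left inner_diff_right power2_norm_eq_inner[of "F s"]
          power2_norm_eq_inner[of "\<alpha> *\<^sub>R s - _"] power2_norm_eq_inner[of "R *v _"]
          inner_commute[of "R *v _" s] right_diff_distrib)
    then show ?thesis using R Omega2_iff(2)[OF \<alpha>, of R] by auto
  qed
  define L where "L = {u. F u = 0}"
  have subL: "subspace L" unfolding L_def by (rule linear_subspace_kernel[OF linF])
  obtain e where e: "0 < e" "\<And>s. s \<in> orthogonal_comp L \<Longrightarrow> e * norm s \<le> norm (F s)"
  proof -
    have "x = 0" if "x \<in> orthogonal_comp L" "F x = 0" for x
      using that by (auto simp: orthogonal_comp_def L_def orthogonal_def)
    then have "\<exists>e>0. \<forall>x\<in>orthogonal_comp L. e * norm x \<le> norm (F x)"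
      by (intro injective_imp_isometric closed_subspace subspace_orthogonal_comp)
        (use linF in \<open>auto simp: linear_conv_bounded_linear\<close>)
    then show ?thesis using that by blast
  qed
  define \<delta> where "\<delta> = e\<^sup>2 / \<alpha>"
  have \<delta>: "0 < \<delta>" using e \<alpha> by (simp add: \<delta>_def)
  have gap: "\<delta> * (norm s)\<^sup>2 \<le> s \<bullet> F s" if "s \<in> orthogonal_comp L" for s
  proof -
    have "(e * norm s)\<^sup>2 \<le> (norm (F s))\<^sup>2" using e that by (intro power_mono) auto
    with F2[of s] \<alpha> show ?thesis
      by (simp add: \<delta>_def power_mult_distrib field_simps)
  qed
  obtain \<beta> where \<beta>: "0 < \<beta>" "\<And>x. norm (B *v x) \<le> norm x * \<beta>"
    using bounded_linear.pos_bounded[OF matrix_vector_mul_bounded_linear[of B]] by blast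
  have B': "x \<bullet> (B *v y) \<le> \<beta> * norm x * norm y" for x y
  proof -
    have "x \<bullet> (B *v y) \<le> norm x * norm (B *v y)" by (rule norm_cauchy_schwarz)
    also have "\<dots> \<le> norm x * (norm y * \<beta>)" by (intro mult_left_mono \<beta>) auto
    finally show ?thesis by (simp add: mult_ac)
  qed
  define c where "c = \<beta>\<^sup>2 / \<delta>"
  show thesis
  proof (rule that)
    show "0 \<le> c" using \<delta> by (simp add: c_def)
  next
    fix t :: real and u :: "real^'n" assume t: "0 \<le> t"
    obtain p s where p: "p \<in> span L" and s: "\<And>w. w \<in> span L \<Longrightarrow> orthogonal s w" and u: "u = p + s"
      using orthogonal_subspace_decomp_exists[of L u] by blast
    have pL: "p \<in> L" using p iffD2[OF span_eq_iff subL] by blast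
    have sL: "s \<in> orthogonal_comp L"
      using s by (auto simp: orthogonal_comp_def span_base orthogonal_commute)
    have ps: "p \<bullet> s = 0" using s[OF p] by (simp add: orthogonal_def inner_commute)
    have nu: "(norm u)\<^sup>2 = (norm p)\<^sup>2 + (norm s)\<^sup>2"
      using ps by (simp add: u power2_norm_eq_inner inner_add_left inner_add_right inner_commute)
    have np: "norm p \<le> norm u" by (rule power2_le_imp_le) (use nu in simp_all)
    have "F p = 0" using pL by (simp add: L_def)
    then have uF: "u \<bullet> F u = s \<bullet> F s"
      using Fself[of p s] by (simp add: u linear_add[OF linF] inner_add_left)
    have "R *v (transpose R *v p) = \<alpha> *\<^sub>R p" using \<open>F p = 0\<close> by (simp add: F_def)
    then have Bp: "p \<bullet> (B *v p) \<le> 0" by (rule B)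
    have "u \<bullet> (B *v u) = p \<bullet> (B *v p) + p \<bullet> (B *v s) + s \<bullet> (B *v u)"
      by (simp add: u matrix_vector_right_distrib inner_add_left inner_add_right)
    also have "\<dots> \<le> 0 + \<beta> * norm p * norm s + \<beta> * norm s * norm u"
      by (intro add_mono Bp B')
    also have "\<dots> \<le> 2 * \<beta> * norm u * norm s"
    proof -
      have "\<beta> * norm p * norm s \<le> \<beta> * norm u * norm s"
        using np \<beta>(1) by (intro mult_right_mono mult_left_mono) auto
      then show ?thesis by (simp add: mult_ac)
    qed
    finally have uB: "t * (u \<bullet> (B *v u)) \<le> t * (2 * \<beta> * norm u * norm s)"
      using t by (rule mult_left_mono)
    have "c * t\<^sup>2 * (norm u)\<^sup>2 - t * (2 * \<beta> * norm u * norm s) + \<delta> * (norm s)\<^sup>2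
        = (\<beta> * t * norm u - \<delta> * norm s)\<^sup>2 / \<delta>"
      using \<delta> by (simp add: c_def power2_eq_square field_simps)
    also have "\<dots> \<ge> 0" using \<delta> by simp
    finally have "t * (2 * \<beta> * norm u * norm s) \<le> c * t\<^sup>2 * (norm u)\<^sup>2 + \<delta> * (norm s)\<^sup>2" by linarith
    moreover have "(\<alpha> + c * t\<^sup>2) * (norm u)\<^sup>2 = \<alpha> * (norm u)\<^sup>2 + c * t\<^sup>2 * (norm u)\<^sup>2"
      by (rule distrib_right)
    moreover have "(norm (transpose R *v u))\<^sup>2 = \<alpha> * (norm u)\<^sup>2 - s \<bullet> F s"
      using normF[of u] uF by simp
    ultimately show "(norm (transpose R *v u))\<^sup>2 + t * (u \<bullet> (B *v u)) \<le> (\<alpha> + c * t\<^sup>2) * (norm u)\<^sup>2"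
      using uB gap[OF sL] by linarith
  qed
qed

lemma scale_in_Omega2:
  fixes Y :: "real^'r^'n"
  assumes \<alpha>: "0 < \<alpha>" and c: "0 \<le> c"
    and Y: "\<And>u. (norm (transpose Y *v u))\<^sup>2 \<le> (\<alpha> + c) * (norm u)\<^sup>2"
  shows "(\<alpha> / (\<alpha> + c)) *\<^sub>R Y \<in> Omega2 \<alpha>"
  unfolding Omega2_iff(1)[OF \<alpha>]
proof
  fix u :: "real^'n"
  let ?s = "\<alpha> / (\<alpha> + c)"
  have s: "0 < ?s" "?s \<le> 1" using \<alpha> c by simp_all
  have "(norm (transpose (?s *\<^sub>R Y) *v u))\<^sup>2 = ?s\<^sup>2 * (norm (transpose Y *v u))\<^sup>2"
    by (simp only: transpose_scaleR scaleR_matrix_vector_assoc[symmetric] norm_scaleR power_mult_distrib power2_abs)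
  also have "\<dots> \<le> ?s\<^sup>2 * ((\<alpha> + c) * (norm u)\<^sup>2)" by (rule mult_left_mono[OF Y]) simp
  also have "\<dots> = ?s * (\<alpha> * (norm u)\<^sup>2)" using \<alpha> c by (simp add: power2_eq_square)
  also have "\<dots> \<le> \<alpha> * (norm u)\<^sup>2"
    using s \<alpha> by (intro mult_left_le_one_le) auto
  finally show "(norm (transpose (?s *\<^sub>R Y) *v u))\<^sup>2 \<le> \<alpha> * (norm u)\<^sup>2" .
qed

text \<open>
  The hypothesis says that \<open>D\<close> does not increase \<open>R R\<^sup>T\<close> to first order on the eigenspace for \<open>\<alpha>\<close>,
  that is, \<open>D\<close> is tangent to the spectral norm ball. Then \<open>R + t D\<close>, scaled by \<open>1 - O(t\<^sup>2)\<close>, lies in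
  the ball, and the inequality defining the normal cone, divided by \<open>t\<close>, gives the claim as \<open>t\<close>
  tends to \<open>0\<close>.
\<close>

lemma normal_cone_inner_nonpos:
  fixes R N D :: "real^'r^'n"
  assumes \<alpha>: "0 < \<alpha>" and N: "N \<in> normal_cone (Omega2 \<alpha>) R"
    and D: "\<And>u. R *v (transpose R *v u) = \<alpha> *\<^sub>R u \<Longrightarrow>
      (transpose R *v u) \<bullet> (transpose D *v u) \<le> 0"
  shows "N \<bullet> D \<le> 0"
proof (rule ccontr)
  assume "\<not> N \<bullet> D \<le> 0"
  then have pos: "0 < N \<bullet> D" by simp
  have R: "R \<in> Omega2 \<alpha>" and NY: "\<And>Y. Y \<in> Omega2 \<alpha> \<Longrightarrow> N \<bullet> Y \<le> N \<bullet> R"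
    using N by (auto simp: normal_cone_def inner_diff_right)
  let ?B = "2 *\<^sub>R (R ** transpose D)"
  have B: "u \<bullet> (?B *v u) = 2 * ((transpose R *v u) \<bullet> (transpose D *v u))" for u
    unfolding scaleR_matrix_vector_assoc[symmetric] matrix_vector_mul_assoc[symmetric] inner_scaleR_right
      inner_matrix_mult[of u] ..
  obtain c where c: "0 \<le> c" and cu: "\<And>t u. 0 \<le> t \<Longrightarrow>
      (norm (transpose R *v u))\<^sup>2 + t * (u \<bullet> (?B *v u)) \<le> (\<alpha> + c * t\<^sup>2) * (norm u)\<^sup>2"
  proof (rule quadratic_perturbation[OF \<alpha> R, of ?B])
    show "u \<bullet> (?B *v u) \<le> 0" if "R *v (transpose R *v u) = \<alpha> *\<^sub>R u" for u
      using D[OF that] unfolding B by linarith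
  qed (rule that)
  obtain K where K: "0 < K" "\<And>u. norm (transpose D *v u) \<le> norm u * K"
    using bounded_linear.pos_bounded[OF matrix_vector_mul_bounded_linear[of "transpose D"]] by blast
  define k where "k = c + K\<^sup>2"
  have k: "0 \<le> k" using c by (simp add: k_def)
  (* Small enough for the error k t (N \<bullet> R) to be at most half of \<alpha> (N \<bullet> D). *)
  define t where "t = \<alpha> * (N \<bullet> D) / (2 * (k * \<bar>N \<bullet> R\<bar> + 1))"
  have den: "0 < k * \<bar>N \<bullet> R\<bar> + 1" using k by (simp add: add_nonneg_pos)
  have t: "0 < t" using \<alpha> pos den by (simp add: t_def)
  have "(norm (transpose (R + t *\<^sub>R D) *v u))\<^sup>2 \<le> (\<alpha> + k * t\<^sup>2) * (norm u)\<^sup>2" for u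
  proof -
    let ?a = "transpose R *v u" and ?b = "transpose D *v u"
    have "(norm ?b)\<^sup>2 \<le> (norm u * K)\<^sup>2" using K by (intro power_mono) auto
    then have "t\<^sup>2 * (norm ?b)\<^sup>2 \<le> t\<^sup>2 * (K\<^sup>2 * (norm u)\<^sup>2)"
      by (intro mult_left_mono) (auto simp: power_mult_distrib mult.commute)
    moreover have "(norm (?a + t *\<^sub>R ?b))\<^sup>2 = (norm ?a)\<^sup>2 + t * (u \<bullet> (?B *v u)) + t\<^sup>2 * (norm ?b)\<^sup>2"
      unfolding B power2_norm_eq_inner
      by (simp add: inner_add_left inner_add_right inner_commute power2_eq_square)
    moreover have "transpose (R + t *\<^sub>R D) *v u = ?a + t *\<^sub>R ?b"
      unfolding transpose_add transpose_scaleR matrix_vector_mult_add_rdistrib scaleR_matrix_vector_assoc[symmetric] ..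
    moreover have "(\<alpha> + k * t\<^sup>2) * (norm u)\<^sup>2 = (\<alpha> + c * t\<^sup>2) * (norm u)\<^sup>2 + t\<^sup>2 * (K\<^sup>2 * (norm u)\<^sup>2)"
      by (simp add: k_def algebra_simps)
    ultimately show ?thesis using cu[of t u] t by (simp only:) linarith
  qed
  then have "(\<alpha> / (\<alpha> + k * t\<^sup>2)) *\<^sub>R (R + t *\<^sub>R D) \<in> Omega2 \<alpha>"
    using k by (intro scale_in_Omega2 \<alpha>) auto
  from NY[OF this] have "\<alpha> * (N \<bullet> R + t * (N \<bullet> D)) / (\<alpha> + k * t\<^sup>2) \<le> N \<bullet> R"
    by (simp add: inner_add_right)
  moreover have "0 < \<alpha> + k * t\<^sup>2" using \<alpha> k by (simp add: add_pos_nonneg)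
  ultimately have "\<alpha> * (N \<bullet> R + t * (N \<bullet> D)) \<le> (N \<bullet> R) * (\<alpha> + k * t\<^sup>2)"
    by (simp add: pos_divide_le_eq)
  then have "t * (\<alpha> * (N \<bullet> D)) \<le> t * (t * (k * (N \<bullet> R)))"
    by (simp add: algebra_simps power2_eq_square)
  then have "\<alpha> * (N \<bullet> D) \<le> t * (k * (N \<bullet> R))" using t by simp
  also have "\<dots> \<le> t * (k * \<bar>N \<bullet> R\<bar> + 1)"
  proof -
    have "k * (N \<bullet> R) \<le> k * \<bar>N \<bullet> R\<bar>" using k by (intro mult_left_mono) auto
    then show ?thesis using t by (intro mult_left_mono) auto
  qed
  also have "\<dots> = \<alpha> * (N \<bullet> D) / 2" using den by (simp add: t_def field_simps)
  finally show False using \<alpha> pos by simp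
qed

text \<open>
  If the squared spectral norm of \<open>Y t\<close> exceeds \<open>\<alpha>\<close> by \<open>O(t\<^bsup>n+1\<^esup>)\<close>, then scaling moves \<open>Y t\<close> into the
  ball over a distance of the same order. The cases \<open>n = 1\<close> and \<open>n = 2\<close> serve the tangent cone and the
  second order tangent set.
\<close>

lemma infdist_K_set_smallo:
  fixes Y :: "real \<Rightarrow> real^'r^'n"
  assumes \<alpha>: "0 < \<alpha>" and c: "0 \<le> c"
    and M: "\<And>t. 0 < t \<Longrightarrow> t < 1 \<Longrightarrow> norm (Y t) \<le> M"
    and Y: "\<And>t u. 0 < t \<Longrightarrow> t < 1 \<Longrightarrow>
      (norm (transpose (Y t) *v u))\<^sup>2 \<le> (\<alpha> + c * t ^ Suc n) * (norm u)\<^sup>2"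
  shows "(\<lambda>t. infdist ((0::real^'k), (0::real^'r), Y t) (K_set \<alpha>)) \<in> o[at_right 0](\<lambda>t. t ^ n)"
proof (rule landau_o.smallI)
  fix e :: real assume e: "0 < e"
  have M0: "0 \<le> M" using M[of "1/2"] norm_ge_zero[of "Y (1/2)"] by linarith
  define L where "L = M * c / \<alpha>"
  have L: "0 \<le> L" using M0 c \<alpha> by (simp add: L_def)
  have bound: "infdist ((0::real^'k), (0::real^'r), Y t) (K_set \<alpha>) \<le> L * t * t ^ n"
    if t: "0 < t" "t < 1" for t
  proof -
    let ?g = "c * t ^ Suc n"
    have g: "0 \<le> ?g" using c t by simp
    let ?Z = "(\<alpha> / (\<alpha> + ?g)) *\<^sub>R Y t"
    have "((0::real^'k), (0::real^'r), ?Z) \<in> K_set \<alpha>"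
      using scale_in_Omega2[OF \<alpha> g Y[OF t]] by (simp add: K_set_def)
    then have "infdist ((0::real^'k), (0::real^'r), Y t) (K_set \<alpha>)
        \<le> dist ((0::real^'k), (0::real^'r), Y t) (0, 0, ?Z)"
      by (rule infdist_le)
    also have "\<dots> = norm (Y t - ?Z)" by (simp add: dist_norm norm_Pair)
    also have "Y t - ?Z = (?g / (\<alpha> + ?g)) *\<^sub>R Y t"
    proof -
      have "1 - \<alpha> / (\<alpha> + ?g) = ?g / (\<alpha> + ?g)" using \<alpha> g by (simp add: field_simps)
      then show ?thesis by (metis scaleR_left_diff_distrib scaleR_one)
    qed
    also have "norm \<dots> = ?g / (\<alpha> + ?g) * norm (Y t)" using \<alpha> g by simp
    also have "\<dots> \<le> ?g / \<alpha> * M"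
    proof (rule mult_mono)
      show "?g / (\<alpha> + ?g) \<le> ?g / \<alpha>" using \<alpha> g by (intro divide_left_mono) auto
    qed (use M[OF t] \<alpha> g in auto)
    also have "\<dots> = L * t * t ^ n" by (simp add: L_def)
    finally show ?thesis .
  qed
  have "\<forall>\<^sub>F t in at_right 0. t < min 1 (e / (L + 1))"
    using e L by (intro order_tendstoD(2)[OF tendsto_ident_at]) simp
  moreover have "\<forall>\<^sub>F t in at_right (0::real). 0 < t" by (rule eventually_at_right_less)
  ultimately show "\<forall>\<^sub>F t in at_right 0.
      norm (infdist ((0::real^'k), (0::real^'r), Y t) (K_set \<alpha>)) \<le> e * norm (t ^ n)"
  proof eventually_elim
    case (elim t)
    have "L * t \<le> (L + 1) * t" using elim by simp
    also have "\<dots> \<le> e" using elim L by (simp add: field_simps)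
    finally have "L * t * t ^ n \<le> e * t ^ n" using elim by (intro mult_right_mono) auto
    then have "infdist ((0::real^'k), (0::real^'r), Y t) (K_set \<alpha>) \<le> e * t ^ n"
      using bound[of t] elim by linarith
    then show ?case using elim(2) by (simp add: infdist_nonneg)
  qed
qed

section \<open>The space \<open>\<Gamma>\<^sub>R\<close> without singular vectors\<close>

text \<open>
  This replaces singular vectors by the eigenspace of \<open>R R\<^sup>T\<close> for \<open>\<alpha>\<close>. There \<open>x = \<Sum> c\<^sub>i u\<^sub>i\<close> and
  \<open>R\<^sup>T x = \<surd>\<alpha> \<Sum> c\<^sub>i v\<^sub>i\<close> over the indices with \<open>\<sigma>\<^sub>i = \<surd>\<alpha>\<close>, so the inner product is a quadratic form in
  \<open>c\<close> with matrix \<open>V\<^sub>1\<^sup>T H\<^sup>T U\<^sub>1\<close>, up to the factor \<open>\<surd>\<alpha>\<close>; membership in \<open>\<Gamma>\<^sub>R\<close> makes this matrix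
  skew-symmetric.
\<close>

lemma Gamma_set_orthogonal:
  fixes R :: "real^'r^'n"
  assumes \<alpha>: "0 < \<alpha>" and svd: "is_svd R u \<sigma> v" and H: "H \<in> Gamma_set \<alpha> u \<sigma> v"
    and x: "R *v (transpose R *v x) = \<alpha> *\<^sub>R x"
  shows "(transpose R *v x) \<bullet> (transpose H *v x) = 0"
proof -
  let ?p = "min CARD('n) CARD('r)"
  have uu: "\<And>i j. i < ?p \<Longrightarrow> j < ?p \<Longrightarrow> u i \<bullet> u j = (if i = j then 1 else 0)"
    and vv: "\<And>i j. i < ?p \<Longrightarrow> j < ?p \<Longrightarrow> v i \<bullet> v j = (if i = j then 1 else 0)"
    and \<sigma>0: "\<And>i. i < ?p \<Longrightarrow> 0 \<le> \<sigma> i"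
    and R: "R = (\<Sum>i<?p. \<sigma> i *\<^sub>R outer (u i) (v i))"
    using svd by (auto simp: is_svd_def Let_def)
  define c where "c = (\<lambda>i. u i \<bullet> x)"
  have Rv: "R *v y = (\<Sum>i<?p. (\<sigma> i * (v i \<bullet> y)) *\<^sub>R u i)" for y
    by (subst R) (simp add: sum_matrix_mult scaleR_matrix_vector_assoc[symmetric] outer_mult)
  have Rt: "transpose R *v x = (\<Sum>i<?p. (\<sigma> i * c i) *\<^sub>R v i)"
    by (subst R, unfold transpose_sum transpose_scaleR transpose_outer sum_matrix_mult
        scaleR_matrix_vector_assoc[symmetric] outer_mult) (simp add: c_def)
  have vR: "v i \<bullet> (transpose R *v x) = \<sigma> i * c i" if "i < ?p" for i
    unfolding Rt inner_sum_right inner_scaleR_right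
    using that by (simp add: vv if_distrib cong: if_cong)
  have xs: "\<alpha> *\<^sub>R x = (\<Sum>i<?p. ((\<sigma> i)\<^sup>2 * c i) *\<^sub>R u i)"
    unfolding x[symmetric] Rv by (intro sum.cong refl) (simp add: vR power2_eq_square)
  have c_eq: "\<alpha> * c j = (\<sigma> j)\<^sup>2 * c j" if "j < ?p" for j
  proof -
    have "\<alpha> * c j = u j \<bullet> (\<alpha> *\<^sub>R x)" by (simp add: c_def)
    also have "\<dots> = (\<sigma> j)\<^sup>2 * c j"
      unfolding xs inner_sum_right inner_scaleR_right
      using that by (simp add: uu if_distrib cong: if_cong)
    finally show ?thesis .
  qed
  then have dich: "c j = 0 \<or> \<sigma> j = sqrt \<alpha>" if "j < ?p" for j
    using that \<sigma>0[OF that] by (metis mult_right_cancel real_sqrt_unique)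
  have "\<alpha> *\<^sub>R x = \<alpha> *\<^sub>R (\<Sum>i<?p. c i *\<^sub>R u i)"
    unfolding xs scaleR_sum_right
    by (intro sum.cong refl) (simp add: c_eq)
  then have x': "x = (\<Sum>i<?p. c i *\<^sub>R u i)" using \<alpha> by simp
  have Rt': "transpose R *v x = sqrt \<alpha> *\<^sub>R (\<Sum>i<?p. c i *\<^sub>R v i)"
    unfolding Rt scaleR_sum_right
  proof (intro sum.cong refl)
    fix i assume "i \<in> {..<?p}"
    then have "\<sigma> i * c i = sqrt \<alpha> * c i" using dich[of i] by auto
    then show "(\<sigma> i * c i) *\<^sub>R v i = sqrt \<alpha> *\<^sub>R c i *\<^sub>R v i" by simp
  qed
  define b where "b = (\<lambda>i j. v i \<bullet> (transpose H *v u j))"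
  have anti: "c i * c j * b i j = - (c j * c i * b j i)" if "i < ?p" "j < ?p" for i j
  proof (cases "c i = 0 \<or> c j = 0")
    case False
    then have "\<sigma> i = sqrt \<alpha>" "\<sigma> j = sqrt \<alpha>" using dich that by auto
    then have "u i \<bullet> (H *v v j) + b i j = 0"
      using H that unfolding Gamma_set_def b_def by blast
    moreover have "u i \<bullet> (H *v v j) = b j i"
      unfolding b_def inner_matrix_mult[of "u i"] by (rule inner_commute)
    ultimately have "b i j = - b j i" by linarith
    then show ?thesis by simp
  qed auto
  define S where "S = (\<Sum>i<?p. \<Sum>j<?p. c i * c j * b i j)"
  have "S = (\<Sum>i<?p. \<Sum>j<?p. - (c j * c i * b j i))"
    unfolding S_def by (intro sum.cong refl anti) auto
  also have "\<dots> = - S"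
    unfolding S_def sum_negf by (subst sum.swap) simp
  finally have "S = 0" by simp
  have S_swap: "S = (\<Sum>j<?p. \<Sum>i<?p. c i * c j * b i j)"
    unfolding S_def by (rule sum.swap)
  have Hx: "transpose H *v x = (\<Sum>j<?p. c j *\<^sub>R (transpose H *v u j))"
    by (subst x', simp only: linear_sum[OF matrix_vector_mul_linear] matrix_vector_mult_scaleR)
  have "(transpose R *v x) \<bullet> (transpose H *v x) = sqrt \<alpha> * S"
    unfolding Rt' Hx S_swap b_def inner_scaleR_left inner_scaleR_right inner_sum_left inner_sum_right
    by (simp add: sum_distrib_left mult_ac)
  then show ?thesis using \<open>S = 0\<close> by simp
qed

section \<open>Curvature along rank-deficient directions\<close>

lemma linear_on_sym_diff:
  assumes "linear_on_sym A" and X: "X \<in> sym_mats" and Y: "Y \<in> sym_mats"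
  shows "A (X - Y) = A X - A Y"
proof -
  have "(-1) *\<^sub>R Y \<in> sym_mats" using Y by (simp add: sym_mats_def transpose_scaleR del: scaleR_minus_left scaleR_minus1_left)
  then have "A (X + (-1) *\<^sub>R Y) = A X + (-1) *\<^sub>R A Y"
    using assms unfolding linear_on_sym_def by metis
  then show ?thesis by simp
qed

lemma linear_on_sym_0: "linear_on_sym A \<Longrightarrow> A 0 = 0"
  using linear_on_sym_diff[of A 0 0] by (simp add: sym_mats_def transpose_def vec_eq_iff)

text \<open>
  Because \<open>R q = 0\<close>, the term of order \<open>t\<close> in \<open>Y\<^sub>t Y\<^sub>t\<^sup>T\<close> vanishes for \<open>Y\<^sub>t = R + t x q\<^sup>T + t\<^sup>2 w / 2\<close>, and
  the hypothesis on \<open>w\<close> says that the term of order \<open>t\<^sup>2\<close> vanishes on the eigenspace for \<open>\<alpha>\<close>. Applying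
  \<open>quadratic_perturbation\<close> with \<open>t\<^sup>2\<close> for \<open>t\<close> costs \<open>O(t\<^sup>4)\<close>; the cubic cross term of \<open>x q\<^sup>T\<close> and \<open>w\<close>
  dominates.
\<close>

lemma feasible_curve_bound:
  fixes R w :: "real^'r^'n"
  assumes \<alpha>: "0 < \<alpha>" and R: "R \<in> Omega2 \<alpha>"
    and q: "norm q = 1" "R *v q = 0"
    and w: "\<And>u. R *v (transpose R *v u) = \<alpha> *\<^sub>R u \<Longrightarrow>
      (x \<bullet> u)\<^sup>2 + (transpose R *v u) \<bullet> (transpose w *v u) = 0"
  obtains c where "0 \<le> c" and "\<And>t u. 0 < t \<Longrightarrow> t < 1 \<Longrightarrow>
      (norm (transpose (R + t *\<^sub>R outer x q + (t\<^sup>2 / 2) *\<^sub>R w) *v u))\<^sup>2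
        \<le> (\<alpha> + c * t ^ 3) * (norm u)\<^sup>2"
proof -
  let ?B = "outer x x + R ** transpose w"
  have B: "u \<bullet> (?B *v u) = (x \<bullet> u)\<^sup>2 + (transpose R *v u) \<bullet> (transpose w *v u)" for u
    unfolding matrix_vector_mult_add_rdistrib matrix_vector_mul_assoc[symmetric]
      inner_add_right inner_matrix_mult[of u R] outer_mult
    by (simp add: inner_commute power2_eq_square)
  obtain c where c: "0 \<le> c" and cu: "\<And>t u. 0 \<le> t \<Longrightarrow>
      (norm (transpose R *v u))\<^sup>2 + t * (u \<bullet> (?B *v u)) \<le> (\<alpha> + c * t\<^sup>2) * (norm u)\<^sup>2"
  proof (rule quadratic_perturbation[OF \<alpha> R, of ?B])
    show "u \<bullet> (?B *v u) \<le> 0" if "R *v (transpose R *v u) = \<alpha> *\<^sub>R u" for u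
      using w[OF that] unfolding B by linarith
  qed (rule that)
  obtain K where K: "0 < K" "\<And>u. norm (transpose w *v u) \<le> norm u * K"
    using bounded_linear.pos_bounded[OF matrix_vector_mul_bounded_linear[of "transpose w"]] by blast
  define k where "k = c + norm x * K + K\<^sup>2"
  show thesis
  proof (rule that)
    show "0 \<le> k" using c K by (simp add: k_def)
  next
    fix t :: real and u :: "real^'n" assume t: "0 < t" "t < 1"
    let ?a = "transpose R *v u" and ?b = "transpose w *v u" and ?s = "x \<bullet> u"
    have aq: "?a \<bullet> q = 0" using inner_matrix_mult[of u R q] q by simp
    have qq: "q \<bullet> q = 1" using q by (simp add: norm_eq_1)
    have Yu: "transpose (R + t *\<^sub>R outer x q + (t\<^sup>2 / 2) *\<^sub>R w) *v u
        = ?a + (t * ?s) *\<^sub>R q + (t\<^sup>2 / 2) *\<^sub>R ?b"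
      unfolding transpose_add transpose_scaleR transpose_outer matrix_vector_mult_add_rdistrib
        scaleR_matrix_vector_assoc[symmetric] outer_mult by simp
    have expand: "(norm (?a + (t * ?s) *\<^sub>R q + (t\<^sup>2 / 2) *\<^sub>R ?b))\<^sup>2
        = ((norm ?a)\<^sup>2 + t\<^sup>2 * (?s\<^sup>2 + ?a \<bullet> ?b)) + t^3 * (?s * (q \<bullet> ?b)) + t^4 * ((norm ?b)\<^sup>2 / 4)"
      unfolding power2_norm_eq_inner inner_add_left inner_add_right inner_scaleR_left
        inner_scaleR_right inner_commute[of q ?a] inner_commute[of ?b ?a] inner_commute[of ?b q] aq qq
      by (simp add: algebra_simps power2_eq_square power3_eq_cube power4_eq_xxxx)
    have main: "(norm ?a)\<^sup>2 + t\<^sup>2 * (?s\<^sup>2 + ?a \<bullet> ?b) \<le> \<alpha> * (norm u)\<^sup>2 + t^4 * (c * (norm u)\<^sup>2)"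
      using cu[of "t\<^sup>2" u] unfolding B by (simp add: algebra_simps)
    have t43: "t^4 \<le> t^3" using t by (intro power_decreasing) auto
    have nb: "(norm ?b)\<^sup>2 \<le> K\<^sup>2 * (norm u)\<^sup>2"
      using power_mono[OF K(2)[of u], of 2] by (simp add: power_mult_distrib mult.commute)
    have "?s * (q \<bullet> ?b) \<le> \<bar>?s\<bar> * \<bar>q \<bullet> ?b\<bar>" by (metis abs_ge_self abs_mult)
    also have "\<dots> \<le> (norm x * norm u) * (norm u * K)"
    proof (rule mult_mono)
      show "\<bar>q \<bullet> ?b\<bar> \<le> norm u * K"
        using Cauchy_Schwarz_ineq2[of q ?b] q K(2)[of u] by simp
    qed (auto simp: Cauchy_Schwarz_ineq2)
    finally have cross: "?s * (q \<bullet> ?b) \<le> norm x * K * (norm u)\<^sup>2"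
      by (simp add: power2_eq_square mult_ac)
    have "t^3 * (?s * (q \<bullet> ?b)) \<le> t^3 * (norm x * K * (norm u)\<^sup>2)"
      using cross t by (intro mult_left_mono) auto
    moreover have "t^4 * ((norm ?b)\<^sup>2 / 4) \<le> t^3 * (K\<^sup>2 * (norm u)\<^sup>2)"
    proof (rule mult_mono[OF t43])
      have "(norm ?b)\<^sup>2 / 4 \<le> (norm ?b)\<^sup>2" by simp
      then show "(norm ?b)\<^sup>2 / 4 \<le> K\<^sup>2 * (norm u)\<^sup>2" using nb by linarith
    qed (use t in auto)
    moreover have "t^4 * (c * (norm u)\<^sup>2) \<le> t^3 * (c * (norm u)\<^sup>2)"
      using t43 c by (intro mult_right_mono) auto
    moreover have "(\<alpha> + k * t^3) * (norm u)\<^sup>2 = \<alpha> * (norm u)\<^sup>2 + t^3 * (c * (norm u)\<^sup>2)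
        + t^3 * (norm x * K * (norm u)\<^sup>2) + t^3 * (K\<^sup>2 * (norm u)\<^sup>2)"
      by (simp add: k_def algebra_simps)
    ultimately show "(norm (transpose (R + t *\<^sub>R outer x q + (t\<^sup>2 / 2) *\<^sub>R w) *v u))\<^sup>2
        \<le> (\<alpha> + k * t^3) * (norm u)\<^sup>2"
      using main unfolding Yu expand by linarith
  qed
qed

text \<open>
  The second order condition for \<open>d = x q\<^sup>T\<close>. Since \<open>R d\<^sup>T = 0\<close>, \<open>d\<^sup>T e = 0\<close> and \<open>d d\<^sup>T = x x\<^sup>T\<close>, the
  first two components of \<open>G'(R) d\<close> vanish, and by the last hypothesis so do those of
  \<open>G'(R) w + G''(R)[d, d]\<close>. Both tangency conditions thus concern only the distance of the curve to
  the spectral norm ball.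
\<close>

lemma curvature_in_null_direction:
  fixes C :: "real^'n^'n" and A :: "real^'n^'n \<Rightarrow> real^'k" and R w :: "real^'r^'n"
  assumes A: "linear_on_sym A" and \<alpha>: "0 < \<alpha>" and feas: "sdplr1_feasible A b \<alpha> R"
    and so: "second_order_cond C A b \<alpha> R"
    and q: "norm q = 1" "R *v q = 0"
    and x: "x \<bullet> ones = 0"
    and w: "\<And>u. R *v (transpose R *v u) = \<alpha> *\<^sub>R u \<Longrightarrow>
      (x \<bullet> u)\<^sup>2 + (transpose R *v u) \<bullet> (transpose w *v u) = 0"
    and gw: "g_map A R w = (- A (outer x x), 0)"
  shows "0 \<le> (C ** R) \<bullet> w + x \<bullet> (C *v x)"
proof -
  let ?d = "outer x q"
  have R: "R \<in> Omega2 \<alpha>" using feas by (simp add: sdplr1_feasible_def Omega2_def)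
  have qq: "q \<bullet> q = 1" using q by (simp add: norm_eq_1)
  have G: "G_map A b R = (0, 0, R)" using feas by (simp add: G_map_def sdplr1_feasible_def)
  have dR: "?d ** transpose R = 0"
    by (simp add: outer_matrix_mult q) (simp add: outer_def vec_eq_iff)
  have "R ** transpose ?d = transpose (?d ** transpose R)"
    by (simp add: matrix_transpose_mul)
  also have "\<dots> = 0" unfolding dR by (simp add: transpose_def vec_eq_iff)
  finally have Gd: "G_deriv A R ?d = (0, 0, ?d)"
    using dR x by (simp add: G_deriv_def g_map_def linear_on_sym_0[OF A] transpose_outer outer_mult)
  have dd: "?d ** transpose ?d = outer x x"
    by (simp add: outer_matrix_mult outer_mult qq)
  then have Gw: "G_deriv A R w + G_deriv2 A ?d = (0, 0, w)"
    by (simp add: G_deriv_def G_deriv2_def gw)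
  have "(\<lambda>t. infdist ((0::real^'k), (0::real^'r), R + t *\<^sub>R ?d) (K_set \<alpha>)) \<in> o[at_right 0](\<lambda>t. t ^ 1)"
  proof (rule infdist_K_set_smallo[OF \<alpha>])
    show "0 \<le> (norm x)\<^sup>2" by simp
    fix t :: real assume t: "0 < t" "t < 1"
    have "norm (R + t *\<^sub>R ?d) \<le> norm R + t * norm ?d"
      using norm_triangle_ineq[of R "t *\<^sub>R ?d"] t by simp
    also have "\<dots> \<le> norm R + norm ?d" using t by (simp add: mult_left_le_one_le)
    finally show "norm (R + t *\<^sub>R ?d) \<le> norm R + norm ?d" .
    fix u
    let ?a = "transpose R *v u"
    have aq: "?a \<bullet> q = 0" using inner_matrix_mult[of u R q] q by simp
    have "transpose (R + t *\<^sub>R ?d) *v u = ?a + (t * (x \<bullet> u)) *\<^sub>R q"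
      unfolding transpose_add transpose_scaleR transpose_outer matrix_vector_mult_add_rdistrib
        scaleR_matrix_vector_assoc[symmetric] outer_mult by simp
    then have "(norm (transpose (R + t *\<^sub>R ?d) *v u))\<^sup>2 = (norm ?a)\<^sup>2 + t\<^sup>2 * (x \<bullet> u)\<^sup>2"
      unfolding power2_norm_eq_inner
      by (simp add: inner_add_left inner_add_right aq inner_commute[of q ?a] qq power2_eq_square)
    moreover have "(norm ?a)\<^sup>2 \<le> \<alpha> * (norm u)\<^sup>2" using R Omega2_iff(1)[OF \<alpha>, of R] by auto
    moreover have "(x \<bullet> u)\<^sup>2 \<le> (norm x)\<^sup>2 * (norm u)\<^sup>2"
      by (metis Cauchy_Schwarz_ineq power2_norm_eq_inner)
    then have "t\<^sup>2 * (x \<bullet> u)\<^sup>2 \<le> t\<^sup>2 * ((norm x)\<^sup>2 * (norm u)\<^sup>2)" by (intro mult_left_mono) auto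
    ultimately show "(norm (transpose (R + t *\<^sub>R ?d) *v u))\<^sup>2 \<le> (\<alpha> + (norm x)\<^sup>2 * t ^ Suc 1) * (norm u)\<^sup>2"
      by (simp add: algebra_simps numeral_2_eq_2)
  qed
  then have T1: "G_deriv A R ?d \<in> tangent_cone (K_set \<alpha>) (G_map A b R)"
    by (simp add: tangent_cone_def G Gd)
  obtain c where c: "0 \<le> c" "\<And>t u. 0 < t \<Longrightarrow> t < 1 \<Longrightarrow>
      (norm (transpose (R + t *\<^sub>R ?d + (t\<^sup>2 / 2) *\<^sub>R w) *v u))\<^sup>2 \<le> (\<alpha> + c * t ^ 3) * (norm u)\<^sup>2"
    using feasible_curve_bound[OF \<alpha> R q w] by blast
  have "(\<lambda>t. infdist ((0::real^'k), (0::real^'r), R + t *\<^sub>R ?d + (t\<^sup>2 / 2) *\<^sub>R w) (K_set \<alpha>))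
      \<in> o[at_right 0](\<lambda>t. t ^ 2)"
  proof (rule infdist_K_set_smallo[OF \<alpha> c(1)])
    fix t :: real assume t: "0 < t" "t < 1"
    have "norm (R + t *\<^sub>R ?d + (t\<^sup>2 / 2) *\<^sub>R w) \<le> norm R + norm (t *\<^sub>R ?d) + norm ((t\<^sup>2 / 2) *\<^sub>R w)"
      by (intro order_trans[OF norm_triangle_ineq] add_right_mono norm_triangle_ineq)
    moreover have "norm (t *\<^sub>R ?d) \<le> norm ?d" using t by (simp add: mult_left_le_one_le)
    moreover have "norm ((t\<^sup>2 / 2) *\<^sub>R w) \<le> norm w"
    proof -
      have "t\<^sup>2 \<le> 1" using t by (simp add: power_le_one)
      then show ?thesis unfolding norm_scaleR by (intro mult_left_le_one_le) auto
    qed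
    ultimately show "norm (R + t *\<^sub>R ?d + (t\<^sup>2 / 2) *\<^sub>R w) \<le> norm R + norm ?d + norm w" by linarith
    show "(norm (transpose (R + t *\<^sub>R ?d + (t\<^sup>2 / 2) *\<^sub>R w) *v u))\<^sup>2 \<le> (\<alpha> + c * t ^ Suc 2) * (norm u)\<^sup>2" for u
      using c(2)[OF t, of u] by (simp add: numeral_3_eq_3)
  qed
  then have T2: "G_deriv A R w + G_deriv2 A ?d
      \<in> inner_tangent2 (K_set \<alpha>) (G_map A b R) (G_deriv A R ?d)"
    by (simp add: inner_tangent2_def G Gd Gw)
  have "(C ** R) \<bullet> ?d = 0"
    by (simp add: inner_outer matrix_vector_mul_assoc[symmetric] q)
  then have "0 \<le> (C ** R) \<bullet> w + (C ** ?d) \<bullet> ?d"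
    using so T1 T2 unfolding second_order_cond_def by blast
  also have "(C ** ?d) \<bullet> ?d = x \<bullet> (C *v x)"
    by (simp add: inner_outer matrix_vector_mul_assoc[symmetric] outer_mult qq)
  finally show ?thesis .
qed

text \<open>
  The slack is nonnegative on \<open>e\<^sup>\<bottom>\<close> because it is the curvature inequality rewritten with the first
  order condition: \<open>\<langle>C R, w\<rangle> = \<langle>A\<^sup>* y, w R\<^sup>T\<rangle> + \<langle>e z\<^sup>T, w\<rangle> - \<langle>N, w\<rangle>\<close>, whose summands are
  \<open>- x\<^sup>T (A\<^sup>* y) x\<close>, \<open>0\<close> and \<open>x\<^sup>T N R\<^sup>T x / \<alpha>\<close> by the choice of \<open>w\<close>.
\<close>

lemma dual_slack_nonneg:
  fixes C :: "real^'n^'n" and A :: "real^'n^'n \<Rightarrow> real^'k" and R N :: "real^'r^'n"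
  assumes A: "linear_on_sym A" and \<alpha>: "0 < \<alpha>" and reg: "regular_point A b \<alpha> R"
    and rank: "rank R < CARD('r)"
    and so: "second_order_cond C A b \<alpha> R"
    and N: "N \<in> normal_cone (Omega2 \<alpha>) R"
    and kkt: "(C - sym_adjoint A y) ** R - outer ones z = - N"
    and x: "x \<bullet> ones = 0"
  shows "0 \<le> x \<bullet> ((C - sym_adjoint A y + (1 / \<alpha>) *\<^sub>R (N ** transpose R)) *v x)"
proof -
  have feas: "sdplr1_feasible A b \<alpha> R"
    using reg by (simp add: regular_point_def G_in_K_set_iff)
  obtain u \<sigma> v where svd: "is_svd R u \<sigma> v" and onto: "g_map A R ` Gamma_set \<alpha> u \<sigma> v = UNIV"
    using reg by (auto simp: regular_point_def)
  obtain q where q: "norm q = 1" "R *v q = 0"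
  proof -
    from rank have "\<not> inj ((*v) R)" by (simp add: less_rank_noninjective)
    then obtain p p' where "p \<noteq> p'" "R *v p = R *v p'" by (auto simp: inj_def)
    then have "R *v ((1 / norm (p - p')) *\<^sub>R (p - p')) = 0" "norm ((1 / norm (p - p')) *\<^sub>R (p - p')) = 1"
      by (simp_all add: matrix_vector_mult_scaleR matrix_vector_mult_diff_distrib)
    then show ?thesis using that by blast
  qed
  define p where "p = R *v (transpose R *v x)"
  define P where "P = (1 / \<alpha>) *\<^sub>R (outer p x + outer x p)"
  define Q where "Q = outer x x"
  have Psym: "P \<in> sym_mats" and Qsym: "Q \<in> sym_mats"
    by (simp_all add: P_def Q_def sym_mats_def transpose_scaleR transpose_add transpose_outer add.commute)
  (* P is the first order effect on R R^T of adding x x^T R / \<alpha> to R; h makes up for it in the linear constraints. *)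
  obtain h where h: "h \<in> Gamma_set \<alpha> u \<sigma> v" and gh: "g_map A R h = ((1/2) *\<^sub>R A P - A Q, 0)"
    using onto by (metis UNIV_I imageE)
  define w where "w = h - (1 / \<alpha>) *\<^sub>R outer x (transpose R *v x)"
  define W where "W = (\<lambda>w. R ** transpose w + w ** transpose R)"
  have Wsym: "W w \<in> sym_mats" for w
    by (simp add: W_def sym_mats_def transpose_add matrix_transpose_mul add.commute)
  have h0: "(transpose R *v u') \<bullet> (transpose h *v u') = 0" if "R *v (transpose R *v u') = \<alpha> *\<^sub>R u'" for u'
    using Gamma_set_orthogonal[OF \<alpha> svd h that] .
  have wt: "transpose w = transpose h - (1 / \<alpha>) *\<^sub>R outer (transpose R *v x) x"
    by (simp add: w_def transpose_diff transpose_scaleR transpose_outer)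
  have Ww: "W w = W h - P"
  proof -
    have 1: "outer x (transpose R *v x) ** transpose R = outer x p"
      by (simp add: outer_matrix_mult p_def)
    have 2: "R ** outer (transpose R *v x) x = outer p x"
    proof -
      have "R ** outer (transpose R *v x) x = transpose (outer x (transpose R *v x) ** transpose R)"
        by (simp add: matrix_transpose_mul transpose_outer)
      then show ?thesis by (simp add: 1 transpose_outer)
    qed
    have ml: "X ** (Y - c *\<^sub>R Z) = X ** Y - c *\<^sub>R (X ** Z)" for X :: "real^'r^'n" and Y Z :: "real^'n^'r" and c
      by (simp add: matrix_matrix_mult_def vec_eq_iff sum_subtractf sum_distrib_left algebra_simps)
    have mr: "(Y - c *\<^sub>R Z) ** X = Y ** X - c *\<^sub>R (Z ** X)" for X :: "real^'n^'r" and Y Z :: "real^'r^'n" and c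
      by (simp add: matrix_matrix_mult_def vec_eq_iff sum_subtractf sum_distrib_left algebra_simps)
    show ?thesis
      unfolding W_def wt ml 2 unfolding w_def mr 1
      by (simp add: P_def scaleR_right_distrib)
  qed
  have AWh: "A (W h) = A P - 2 *\<^sub>R A Q" and h1: "transpose h *v ones = 0"
  proof -
    have "(1/2) *\<^sub>R A (W h) = (1/2) *\<^sub>R A P - A Q" using gh by (simp add: g_map_def W_def)
    then have "2 *\<^sub>R ((1/2) *\<^sub>R A (W h)) = 2 *\<^sub>R ((1/2) *\<^sub>R A P - A Q)" by simp
    then show "A (W h) = A P - 2 *\<^sub>R A Q" by (simp add: scaleR_right_diff_distrib)
    show "transpose h *v ones = 0" using gh by (simp add: g_map_def)
  qed
  have AWw: "A (W w) = - 2 *\<^sub>R A Q"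
    unfolding Ww linear_on_sym_diff[OF A Wsym Psym] AWh by simp
  have w1: "transpose w *v ones = 0"
    by (simp add: wt matrix_vector_mult_diff_rdistrib scaleR_matrix_vector_assoc[symmetric] outer_mult h1 x)
  have gw: "g_map A R w = (- A (outer x x), 0)"
    using AWw w1 by (simp add: g_map_def W_def Q_def)
  have w0: "(x \<bullet> u')\<^sup>2 + (transpose R *v u') \<bullet> (transpose w *v u') = 0"
    if u': "R *v (transpose R *v u') = \<alpha> *\<^sub>R u'" for u'
  proof -
    have "(transpose R *v u') \<bullet> (transpose R *v x) = \<alpha> * (x \<bullet> u')"
      using inner_matrix_mult[of x R "transpose R *v u'"] u' by (simp add: inner_commute)
    then show ?thesis
      using h0[OF u'] \<alpha>
      by (simp add: wt matrix_vector_mult_diff_rdistrib scaleR_matrix_vector_assoc[symmetric] outer_mult inner_diff_right power2_eq_square)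
  qed
  have curv: "0 \<le> (C ** R) \<bullet> w + x \<bullet> (C *v x)"
    by (rule curvature_in_null_direction[OF A \<alpha> feas so q x w0 gw])
  let ?S = "sym_adjoint A y"
  have "(C ** R) \<bullet> w = (?S ** R) \<bullet> w + outer ones z \<bullet> w - N \<bullet> w"
  proof -
    have "(C - ?S) ** R = C ** R - ?S ** R"
      by (simp add: matrix_matrix_mult_def vec_eq_iff sum_subtractf algebra_simps)
    then have "C ** R - ?S ** R - outer ones z = - N" using kkt by (simp only:)
    then have "C ** R = ?S ** R + outer ones z - N" by (simp add: algebra_simps)
    then show ?thesis by (simp add: inner_add_left inner_diff_left)
  qed
  also have "(?S ** R) \<bullet> w = - (x \<bullet> (?S *v x))"
  proof -
    have St: "transpose ?S = ?S" using sym_adjoint(1)[OF A, of y] by (simp add: sym_mats_def)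
    have "(?S ** R) \<bullet> w = ?S \<bullet> (w ** transpose R)" by (rule inner_mult_right_transpose)
    moreover have "?S \<bullet> (w ** transpose R) = ?S \<bullet> (R ** transpose w)"
      using inner_transpose[of ?S "w ** transpose R"] by (simp add: St matrix_transpose_mul)
    ultimately have "2 * ((?S ** R) \<bullet> w) = ?S \<bullet> W w" by (simp add: W_def inner_add_right)
    also have "\<dots> = - 2 * (?S \<bullet> Q)"
      unfolding sym_adjoint(2)[OF A Wsym] sym_adjoint(2)[OF A Qsym] AWw by simp
    finally show ?thesis by (simp add: Q_def inner_outer)
  qed
  also have "outer ones z \<bullet> w = 0"
    using w1 inner_outer[of w ones z] inner_matrix_mult[of ones w z] by (simp add: inner_commute)
  also have "N \<bullet> w = - (1 / \<alpha>) * (x \<bullet> ((N ** transpose R) *v x))"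
  proof -
    (* Both h and -h are tangent, so the normal vector is orthogonal to h. *)
    have "N \<bullet> h \<le> 0" using h0 by (intro normal_cone_inner_nonpos[OF \<alpha> N]) simp
    moreover have "N \<bullet> (- h) \<le> 0"
    proof (rule normal_cone_inner_nonpos[OF \<alpha> N])
      fix u' assume u': "R *v (transpose R *v u') = \<alpha> *\<^sub>R u'"
      have "transpose (- h) = - transpose h" by (simp add: transpose_def vec_eq_iff)
      moreover have "- M *v u' = - (M *v u')" for M :: "real^'n^'r"
        using scaleR_matrix_vector_assoc[of "-1" M u'] by simp
      ultimately show "(transpose R *v u') \<bullet> (transpose (- h) *v u') \<le> 0"
        using h0[OF u'] by simp
    qed
    ultimately have "N \<bullet> h = 0" by simp
    then show ?thesis
      by (simp add: w_def inner_diff_right inner_outer matrix_vector_mul_assoc)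
  qed
  finally show ?thesis using curv
    by (simp add: matrix_vector_mult_add_rdistrib matrix_vector_mult_diff_rdistrib scaleR_matrix_vector_assoc[symmetric]
        inner_add_right inner_diff_right)
qed

section \<open>Global optimality\<close>

lemma sdp1_feasible_if_sdplr1_feasible:
  fixes R :: "real^'r^'n"
  assumes \<alpha>: "0 < \<alpha>" and feas: "sdplr1_feasible A b \<alpha> R"
  shows "sdp1_feasible A b \<alpha> (R ** transpose R)"
proof -
  let ?X = "R ** transpose R"
  have A: "A ?X = b" and R1: "transpose R *v ones = 0" and R: "R \<in> Omega2 \<alpha>"
    using feas by (auto simp: sdplr1_feasible_def Omega2_def)
  have sym: "transpose ?X = ?X" by (simp add: matrix_transpose_mul)
  have X1: "?X *v ones = 0" using R1 by (simp add: matrix_vector_mul_assoc[symmetric])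
  have quad: "u \<bullet> (?X *v u) = (norm (transpose R *v u))\<^sup>2" for u
    by (simp add: matrix_vector_mul_assoc[symmetric] inner_matrix_mult[of u R] power2_norm_eq_inner)
  have "transpose (mat 1 :: real^'n^'n) = mat 1" by (rule transpose_mat)
  then have "psd (\<alpha> *\<^sub>R mat 1 - ?X)"
    using R Omega2_iff(1)[OF \<alpha>, of R]
    by (auto simp: psd_def sym_mats_def transpose_diff transpose_scaleR sym matrix_vector_mult_diff_rdistrib
        scaleR_matrix_vector_assoc[symmetric] inner_diff_right quad power2_norm_eq_inner[symmetric])
  moreover have "psd ?X" by (simp add: psd_def sym_mats_def sym quad)
  ultimately show ?thesis
    by (simp add: sdp1_feasible_def sym_mats_def sym A X1 inner_outer)
qed

text \<open>
  The direction \<open>- a a\<^sup>T R\<close> shrinks \<open>R\<close> along \<open>a\<close>, hence is tangent to the spectral norm ball.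
\<close>

lemma normal_cone_mult_transpose_psd:
  fixes R N :: "real^'r^'n"
  assumes \<alpha>: "0 < \<alpha>" and N: "N \<in> normal_cone (Omega2 \<alpha>) R"
  shows "0 \<le> a \<bullet> ((N ** transpose R) *v a)"
proof -
  have "N \<bullet> outer (- a) (transpose R *v a) \<le> 0"
  proof (rule normal_cone_inner_nonpos[OF \<alpha> N])
    fix u assume u: "R *v (transpose R *v u) = \<alpha> *\<^sub>R u"
    have "(transpose R *v u) \<bullet> (transpose R *v a) = \<alpha> * (a \<bullet> u)"
      using inner_matrix_mult[of a R "transpose R *v u"] u by (simp add: inner_commute)
    then show "(transpose R *v u) \<bullet> (transpose (outer (- a) (transpose R *v a)) *v u) \<le> 0"
      using \<alpha> mult_nonneg_nonneg[of \<alpha> "(a \<bullet> u)\<^sup>2"]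
      by (simp add: transpose_outer outer_mult power2_eq_square mult_ac)
  qed
  then show ?thesis by (simp add: inner_outer matrix_vector_mul_assoc)
qed

theorem lemma2p6:
  fixes C :: "real^'n^'n" and A :: "real^'n^'n \<Rightarrow> real^'k" and b :: "real^'k"
    and \<alpha> :: real and R :: "real^'r^'n"
  assumes "C \<in> sym_mats"
    and "linear_on_sym A"
    and "0 < \<alpha>"
    and "G_map A b R \<in> K_set \<alpha>"
    and "regular_point A b \<alpha> R"
    and "rank R < CARD('r)"
    and "second_order_stationary C A b \<alpha> R"
  shows "is_arg_min (\<lambda>X. C \<bullet> X) (sdp1_feasible A b \<alpha>) (R ** transpose R)
    \<and> is_arg_min (sdplr1_objective C) (sdplr1_feasible A b \<alpha>) R"
proof -
  note A = assms(2) and \<alpha> = assms(3)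
  have feas: "sdplr1_feasible A b \<alpha> R" using assms(4) by (simp add: G_in_K_set_iff)
  obtain y z where "(C - sym_adjoint A y) ** R - outer ones z \<in> uminus ` normal_cone (Omega2 \<alpha>) R"
    using assms(7) by (auto simp: second_order_stationary_def first_order_cond_def)
  then obtain N where N: "N \<in> normal_cone (Omega2 \<alpha>) R"
    and kkt: "(C - sym_adjoint A y) ** R - outer ones z = - N" by auto
  have so: "second_order_cond C A b \<alpha> R" using assms(7) by (simp add: second_order_stationary_def)
  define S where "S = C - sym_adjoint A y"
  define W where "W = (1 / \<alpha>) *\<^sub>R (N ** transpose R)"
  have Xsym: "R ** transpose R \<in> sym_mats" by (simp add: sym_mats_def matrix_transpose_mul)
  have R1: "transpose R *v ones = 0" and AR: "A (R ** transpose R) = b"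
    using feas by (simp_all add: sdplr1_feasible_def)
  have SR: "S \<bullet> (R ** transpose R) = - (N \<bullet> R)"
  proof -
    have "S \<bullet> (R ** transpose R) = (S ** R) \<bullet> R" by (rule inner_mult_right_transpose[symmetric])
    also have "S ** R = outer ones z - N" using kkt by (simp add: S_def algebra_simps)
    also have "(outer ones z - N) \<bullet> R = - (N \<bullet> R)"
    proof -
      have "outer ones z \<bullet> R = 0"
        using R1 inner_outer[of R ones z] inner_matrix_mult[of ones R z] by (simp add: inner_commute)
      then show ?thesis by (simp add: inner_diff_left)
    qed
    finally show ?thesis .
  qed
  have CS: "C \<bullet> X = S \<bullet> X + y \<bullet> A X" if "X \<in> sym_mats" for X
    using sym_adjoint(2)[OF A that, of y] by (simp add: S_def inner_diff_left)
  have opt: "C \<bullet> (R ** transpose R) \<le> C \<bullet> X" if X: "sdp1_feasible A b \<alpha> X" for X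
  proof -
    have Xs: "X \<in> sym_mats" and AX: "A X = b" and X1: "X *v ones = 0"
      and up: "psd (\<alpha> *\<^sub>R mat 1 - X)" and lo: "psd X"
      using X by (auto simp: sdp1_feasible_def)
    have "0 \<le> (S + W) \<bullet> X"
    proof (rule inner_psd_nonneg[OF lo])
      fix x assume "x \<in> range ((*v) X)"
      then obtain x' where "x = X *v x'" by blast
      then have "x \<bullet> ones = 0"
        using Xs X1 inner_matrix_mult[of ones X x'] by (simp add: sym_mats_def inner_commute)
      then show "0 \<le> x \<bullet> ((S + W) *v x)"
        unfolding S_def W_def by (rule dual_slack_nonneg[OF A \<alpha> assms(5,6) so N kkt])
    qed
    moreover have "0 \<le> W \<bullet> (\<alpha> *\<^sub>R mat 1 - X)"
      by (rule inner_psd_nonneg[OF up])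
        (use normal_cone_mult_transpose_psd[OF \<alpha> N] \<alpha> in \<open>simp add: W_def scaleR_matrix_vector_assoc[symmetric]\<close>)
    moreover have "W \<bullet> (\<alpha> *\<^sub>R mat 1) = N \<bullet> R"
      using \<alpha> inner_mult_right_transpose[of N "transpose R" "mat 1"] by (simp add: W_def)
    ultimately have "- (N \<bullet> R) \<le> S \<bullet> X" by (simp add: inner_add_left inner_diff_right)
    then show ?thesis using CS[OF Xs] CS[OF Xsym] SR AX AR by simp
  qed
  have "is_arg_min (\<lambda>X. C \<bullet> X) (sdp1_feasible A b \<alpha>) (R ** transpose R)"
    using opt sdp1_feasible_if_sdplr1_feasible[OF \<alpha> feas] by (simp add: is_arg_min_linorder)
  moreover have "is_arg_min (sdplr1_objective C) (sdplr1_feasible A b \<alpha>) R"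
  proof -
    have "C \<bullet> (R ** transpose R) \<le> C \<bullet> (Y ** transpose Y)"
      if "sdplr1_feasible A b \<alpha> Y" for Y :: "real^'r^'n"
      by (rule opt[OF sdp1_feasible_if_sdplr1_feasible[OF \<alpha> that]])
    then show ?thesis using feas by (simp add: is_arg_min_linorder sdplr1_objective_def)
  qed
  ultimately show ?thesis by blast
qed

end
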